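(* Let $N$ be a positive integer, let $ABC$ be a triangle, and suppose $ABC$ is $N$-tiled by a triangle $T$ similar to $ABC$. If $N$ is not a square, then $T$ and $ABC$ are right triangles, and either (i) $N$ is three times a square and $T$ is a triangle with angles $30^\circ, 60^\circ, 90^\circ$, or (ii) $N$ is a sum of two squares $N = e^2+f^2$ for integers $e,f$ such that the acute angles of $ABC$ have rational tangents $e/f$ and $f/e$, and the right angle of $ABC$ is split by the tiling; and the alternatives (i) and (ii) are mutually exclusive.
   Context: An $N$-tiling of a triangle $ABC$ by a triangle $T$ (the tile) is a set of $N$ triangles $T_1,\dots,T_N$, each congruent to $T$ (reflections allowed), with pairwise disjoint interiors, whose union is the closed triangle $ABC$. Tiles need not meet edge-to-edge. An angle of $ABC$ is split by the tiling if at least two tiles have a vertex at the corresponding vertex of $ABC$. *)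

theory Defs
  imports "HOL-Analysis.Analysis"
begin

type_synonym point = "real^2"

text \<open>A triangle is represented by the set of its three vertices; the closed region that
  it bounds is the convex hull of that set.\<close>

definition is_triangle :: "point set \<Rightarrow> bool" where
  "is_triangle V \<longleftrightarrow> card V = 3 \<and> \<not> collinear V"

text \<open>The (unoriented) angle at the middle argument. It is meaningful only if the middle point
  differs from the other two: by the convention for division by zero, it is \<open>pi / 2\<close> otherwise.\<close>

definition angle :: "point \<Rightarrow> point \<Rightarrow> point \<Rightarrow> real" where
  "angle X Y Z = arccos (((X - Y) \<bullet> (Z - Y)) / (norm (X - Y) * norm (Z - Y)))"

definition is_right_triangle :: "point set \<Rightarrow> bool" where
  "is_right_triangle V \<longleftrightarrow> is_triangle V \<and>
     (\<exists>X Y Z. V = {X, Y, Z} \<and> angle X Z Y = pi / 2)"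

definition is_30_60_90_triangle :: "point set \<Rightarrow> bool" where
  "is_30_60_90_triangle V \<longleftrightarrow> is_triangle V \<and>
     (\<exists>X Y Z. V = {X, Y, Z} \<and>
        angle Y X Z = pi / 6 \<and> angle X Y Z = pi / 3 \<and> angle X Z Y = pi / 2)"

text \<open>Isometries and similarities of the plane may reverse the orientation, so reflections
  are allowed.\<close>

definition similar :: "point set \<Rightarrow> point set \<Rightarrow> bool" where
  "similar V W \<longleftrightarrow>
     (\<exists>k f. k > 0 \<and> (\<forall>x y. dist (f x) (f y) = k * dist x y) \<and> f ` V = W)"

definition congruent :: "point set \<Rightarrow> point set \<Rightarrow> bool" where
  "congruent V W \<longleftrightarrow> (\<exists>f. (\<forall>x y. dist (f x) (f y) = dist x y) \<and> f ` V = W)"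

definition is_tiling :: "nat \<Rightarrow> point set set \<Rightarrow> point set \<Rightarrow> point set \<Rightarrow> bool" where
  "is_tiling N \<T> T V \<longleftrightarrow>
     finite \<T> \<and> card \<T> = N \<and>
     (\<forall>U\<in>\<T>. congruent T U) \<and>
     pairwise (\<lambda>U W. interior (convex hull U) \<inter> interior (convex hull W) = {}) \<T> \<and>
     (\<Union>U\<in>\<T>. convex hull U) = convex hull V"

definition splits_angle_at :: "point set set \<Rightarrow> point \<Rightarrow> bool" where
  "splits_angle_at \<T> Z \<longleftrightarrow> card {U \<in> \<T>. Z \<in> U} \<ge> 2"

definition three_times_square_case :: "nat \<Rightarrow> point set \<Rightarrow> bool" where
  "three_times_square_case N T \<longleftrightarrow> (\<exists>m::nat. N = 3 * m\<^sup>2) \<and> is_30_60_90_triangle T"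

text \<open>Here \<open>V\<close> is the tiled triangle and \<open>Z\<close> the vertex at its right angle.\<close>

definition sum_of_squares_case :: "nat \<Rightarrow> point set set \<Rightarrow> point set \<Rightarrow> bool" where
  "sum_of_squares_case N \<T> V \<longleftrightarrow>
     (\<exists>(e::int) (f::int) X Y Z.
        int N = e\<^sup>2 + f\<^sup>2 \<and>
        V = {X, Y, Z} \<and>
        angle X Z Y = pi / 2 \<and>
        tan (angle Y X Z) = of_int e / of_int f \<and>
        tan (angle X Y Z) = of_int f / of_int e \<and>
        splits_angle_at \<T> Z)"

end

theory Submission
  imports Defs
begin

text \<open>
  Let \<open>a\<close>, \<open>b\<close>, \<open>c\<close> be the sides of the tile, opposite to its angles \<open>\<alpha> \<le> \<beta> \<le> \<gamma>\<close>. By comparing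
  areas, the tiled triangle has the sides \<open>s a\<close>, \<open>s b\<close>, \<open>s c\<close> with \<open>s\<^sup>2 = N\<close>, and each of them is
  a sum of sides of tiles. If \<open>s\<close> is irrational, there is an additive \<open>\<phi>\<close> with
  \<open>\<phi> (s x) = - s \<phi> x\<close> that does not vanish on all sides. Give a side \<open>x\<close> that maximises \<open>\<bar>\<phi> x\<bar> / x\<close> the
  sign of \<open>\<phi> x\<close>, and the others no sign. Then both signs occur, and the side \<open>s x\<close> is made up only of
  edges of sign opposite to that of \<open>x\<close>. In particular, the two sides of the tile adjacent to an
  angle that is not split have opposite signs. This applies to \<open>\<alpha>\<close>, so no edge of length \<open>c\<close>
  lies on the side \<open>s c\<close>, and a pigeonhole argument for the \<open>\<gamma>\<close>-vertices of the tiles on that side yields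
  \<open>\<gamma> = pi / 2\<close>. If \<open>a\<close> and \<open>b\<close> have the same sign, \<open>\<gamma>\<close> is split, \<open>s a\<close> and \<open>s b\<close>
  are natural multiples \<open>x c\<close> and \<open>y c\<close>, and \<open>N = x\<^sup>2 + y\<^sup>2\<close>. Otherwise \<open>\<beta>\<close> is split, hence is a multiple
  of \<open>\<alpha>\<close>, and \<open>(cos \<alpha>)\<^sup>2\<close> is rational, which forces \<open>\<alpha> = pi / 6\<close>.
\<close>

section \<open>Rational cosines and additive maps\<close>

text \<open>An additive map yields only one equation per side of the tiled triangle, while a
  statement about every single edge is wanted. The sign of \<open>\<phi> x\<close> alone would not
  give it, since edges of both signs could balance each other. At the extreme ratio there is no
  slack: a single deviating edge would have to be compensated by one beyond the maximum. An unsplit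
  corner exchanges signs by elimination. Its only tile has its sides \<open>x\<close> and
  \<open>y\<close> on the sides \<open>s x\<close> and \<open>s y\<close>, and a side with a nonzero
  sign carries no edge of its own length, so \<open>x\<close> lies on \<open>s y\<close> and
  \<open>y\<close> on \<open>s x\<close>. They cannot both be neutral, because the third length
  cannot carry both signs. The angle 30 degrees appears because \<open>2 * \<alpha>\<close> is
  \<open>pi / m\<close> with \<open>m \<ge> 3\<close>, and only \<open>m = 3\<close> gives a
  rational cosine. Tiles need not meet edge-to-edge, and a tile may touch a side in one vertex or
  have a point of the side inside an edge. The geometry is therefore reduced to coverings of an
  interval, by positions along a side and by directions at a point of it.\<close>

lemma cos_pi_div_rational:
  assumes "m \<ge> 3" "cos (pi / real m) \<in> \<rat>"
  shows "m = 3"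
proof -
  \<comment> \<open>Twice the cosine, because \<open>2 * cos (n * t)\<close> is a monic integer
    polynomial in \<open>2 * cos t\<close>. What follows is the rational root argument for such a
    polynomial, carried out directly on \<open>p\<close> and \<open>q\<close>.\<close>
  define x where "x = 2 * cos (pi / real m)"
  have "x \<in> \<rat>" unfolding x_def using assms by auto
  then obtain p q :: int where q: "q > 0" "coprime p q" and x: "x = of_int p / of_int q"
    using Rats_cases' by metis
  have rec: "2 * cos (real (Suc (Suc n)) * t) = 2 * cos t * (2 * cos (real (Suc n) * t)) - 2 * cos (real n * t)"
    for n t
  proof -
    have "cos (real (Suc (Suc n)) * t) + cos (real n * t) = 2 * cos (real (Suc n) * t) * cos t"
      using cos_add[of "real (Suc n) * t" t] cos_diff[of "real (Suc n) * t" t] by (simp add: algebra_simps)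
    then show ?thesis by (simp add: algebra_simps)
  qed
  \<comment> \<open>Two consecutive multiples are carried along because the recurrence has two
    terms. The start is at 1: for \<open>n = 0\<close> the value is 2, which need not be congruent
    to \<open>p ^ 0\<close> modulo \<open>q\<close>.\<close>
  have "(\<exists>z. of_int q ^ n * (2 * cos (real n * (pi / m))) = of_int z \<and> q dvd z - p ^ n) \<and>
        (\<exists>z. of_int q ^ Suc n * (2 * cos (real (Suc n) * (pi / m))) = of_int z \<and> q dvd z - p ^ Suc n)"
    if "n > 0" for n
    using that
  proof (induction n rule: nat_induct_non_zero)
    case 1
    have "of_int q * (2 * cos (pi / m)) = of_int p"
      using q x by (simp add: x_def field_simps)
    moreover have "of_int q * of_int q * (2 * cos (2 * (pi / m))) = of_int (p * p - 2 * q * q)"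
    proof -
      have "2 * cos (2 * (pi / m)) = x * x - 2"
        unfolding x_def cos_double_cos by (simp add: power2_eq_square)
      moreover have "of_int q * x = of_int p" using q x by simp
      moreover have "of_int q * of_int q * (x * x - 2) = (of_int q * x) * (of_int q * x) - 2 * of_int q * of_int q"
        by (simp add: algebra_simps)
      ultimately show ?thesis by simp
    qed
    moreover have "q dvd p * p - 2 * q * q - p * p" by simp
    ultimately show ?case
      by (intro conjI exI[of _ p] exI[of _ "p * p - 2 * q * q"]) (auto simp: mult_ac)
  next
    case (Suc n)
    from Suc.IH obtain y where y: "of_int q ^ n * (2 * cos (real n * (pi / m))) = of_int y" by (elim conjE exE)
    from Suc.IH obtain z where z: "of_int q ^ Suc n * (2 * cos (real (Suc n) * (pi / m))) = of_int z"
      "q dvd z - p ^ Suc n" by (elim conjE exE)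
    have "of_int q ^ Suc (Suc n) * (2 * cos (real (Suc (Suc n)) * (pi / m)))
      = (of_int q * x) * (of_int q ^ Suc n * (2 * cos (real (Suc n) * (pi / m)))) - of_int q * of_int q * (of_int q ^ n * (2 * cos (real n * (pi / m))))"
      unfolding rec x_def by (simp add: algebra_simps)
    also have "\<dots> = of_int (p * z - q * q * y)"
      unfolding y z(1) using q x by simp
    finally have *: "of_int q ^ Suc (Suc n) * (2 * cos (real (Suc (Suc n)) * (pi / m))) = of_int (p * z - q * q * y)" .
    have "p * z - q * q * y - p ^ Suc (Suc n) = p * (z - p ^ Suc n) - q * (q * y)"
      by (simp add: algebra_simps)
    then have "q dvd p * z - q * q * y - p ^ Suc (Suc n)"
      using z(2) by (simp only: dvd_diff dvd_mult dvd_triv_left)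
    with * have "\<exists>z. of_int q ^ Suc (Suc n) * (2 * cos (real (Suc (Suc n)) * (pi / m))) = of_int z \<and>
      q dvd z - p ^ Suc (Suc n)" by (intro exI[of _ "p * z - q * q * y"] conjI)
    moreover have "\<exists>z. of_int q ^ Suc n * (2 * cos (real (Suc n) * (pi / m))) = of_int z \<and>
      q dvd z - p ^ Suc n" by (intro exI[of _ z] conjI z)
    ultimately show ?case by (intro conjI)
  qed
  note multiples = this
  have "m > 0" using assms(1) by simp
  from multiples[OF this] obtain z where z: "of_int q ^ m * (2 * cos (real m * (pi / m))) = of_int z" "q dvd z - p ^ m"
    by (elim conjE exE)
  \<comment> \<open>At the multiple \<open>m\<close> the angle is \<open>pi\<close> and the value is
    -2, so \<open>q\<close> divides \<open>z\<close> and hence \<open>p ^ m\<close>. Then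
    \<open>x\<close> is an integer, and it lies between 1 (included) and 2 (excluded).\<close>
  have "of_int z = (of_int (- 2 * q ^ m) :: real)" using z(1) assms(1) by simp
  then have "z = - 2 * q ^ m" by linarith
  moreover have "q dvd q ^ m" using assms(1) by simp
  ultimately have "q dvd p ^ m" using z(2) dvd_diff[of q z "z - p ^ m"] by simp
  moreover have "coprime q (p ^ m)" using q(2) by (simp add: coprime_commute)
  ultimately have "q = 1" using q(1) coprime_common_divisor[of q "p ^ m" q] by auto
  have "cos (pi / 3) \<le> cos (pi / m)"
    using assms(1) by (intro cos_monotone_0_pi_le) (auto simp: field_simps)
  then have "1 \<le> x" by (simp add: x_def cos_60)
  have "cos (pi / m) < cos 0"
    using assms(1) by (intro cos_monotone_0_pi) (auto simp: field_simps)
  then have "x < 2" by (simp add: x_def)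
  have "p = 1" using x \<open>q = 1\<close> \<open>1 \<le> x\<close> \<open>x < 2\<close> by simp
  then have "cos (pi / m) = 1 / 2" using x \<open>q = 1\<close> by (simp add: x_def)
  then have "arccos (cos (pi / m)) = arccos (cos (pi / 3))" by (simp only: cos_60)
  moreover have "arccos (cos (pi / m)) = pi / m"
    by (rule arccos_cos) (use assms(1) in \<open>simp_all add: divide_le_eq\<close>)
  moreover have "arccos (cos (pi / 3)) = pi / 3" by (rule arccos_cos) simp_all
  ultimately have "pi / m = pi / 3" by (simp only:)
  then have "pi * 3 = pi * m" using assms(1) by (subst (asm) frac_eq_eq) auto
  then show ?thesis by simp
qed

text \<open>For a map \<open>f\<close> that is linear over the rationals and has rational values, with \<open>f a = 1\<close>, take \<open>\<phi> x = f (s x) - s f x\<close>.\<close>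

lemma additive_conjugation:
  fixes s a :: real
  assumes "s \<notin> \<rat>" "s\<^sup>2 \<in> \<rat>" "a \<noteq> 0"
  obtains \<phi> :: "real \<Rightarrow> real" where
    "\<And>x y. \<phi> (x + y) = \<phi> x + \<phi> y" "\<And>x. \<phi> (s * x) = - s * \<phi> x" "\<phi> a \<noteq> 0"
proof -
  interpret V: vector_space "\<lambda>(q::rat) (x::real). of_rat q * x"
    by unfold_locales (auto simp: algebra_simps of_rat_add of_rat_mult)
  interpret W: vector_space "\<lambda>(q::rat) (x::rat). q * x"
    by unfold_locales (auto simp: algebra_simps)
  interpret P: vector_space_pair "\<lambda>(q::rat) (x::real). of_rat q * x" "\<lambda>(q::rat) (x::rat). q * x" ..
  have "V.independent {a}" using assms(3) by simp
  then obtain f where f: "Vector_Spaces.linear (\<lambda>(q::rat) (x::real). of_rat q * x) (\<lambda>(q::rat) (x::rat). q * x) f" "f a = 1"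
    using P.linear_independent_extend[of "{a}" "\<lambda>_. 1"] by auto
  interpret f: Vector_Spaces.linear "\<lambda>(q::rat) (x::real). of_rat q * x" "\<lambda>(q::rat) (x::rat). q * x" f by fact
  obtain r where r: "s\<^sup>2 = of_rat r" using assms(2) by (auto elim: Rats_cases)
  show ?thesis
  proof (rule that[of "\<lambda>x. of_rat (f (s * x)) - s * of_rat (f x)"])
    fix x y show "of_rat (f (s * (x + y))) - s * of_rat (f (x + y)) =
           of_rat (f (s * x)) - s * of_rat (f x) + (of_rat (f (s * y)) - s * of_rat (f y))"
      by (simp add: algebra_simps f.add of_rat_add)
  next
    fix x
    \<comment> \<open>Multiplication by \<open>s\<close> twice is multiplication by the rational
      \<open>r\<close>, with which \<open>f\<close> commutes.\<close>
    have "f (s * (s * x)) = r * f x" using f.scale[of r x] r by (simp add: power2_eq_square flip: mult.assoc)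
    then have "of_rat (f (s * (s * x))) = s\<^sup>2 * of_rat (f x)" by (simp add: r of_rat_mult)
    then show "of_rat (f (s * (s * x))) - s * of_rat (f (s * x)) = - s * (of_rat (f (s * x)) - s * of_rat (f x))"
      by (simp add: algebra_simps power2_eq_square)
  next
    \<comment> \<open>With \<open>f a = 1\<close>, a zero here would make \<open>s\<close> equal to
      the rational number \<open>f (s * a)\<close>.\<close>
    show "of_rat (f (s * a)) - s * of_rat (f a) \<noteq> 0"
      using assms(1) f(2) by (metis Rats_of_rat eq_iff_diff_eq_0 mult.right_neutral of_rat_1)
  qed
qed

section \<open>Coverings of an interval by finitely many closed intervals\<close>

text \<open>Take a point slightly to the right of \<open>x\<close>, before every left end beyond
  \<open>x\<close>. An interval that covers it must start at or before \<open>x\<close>.\<close>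

lemma interval_cover_right:
  fixes l r :: "'a \<Rightarrow> real"
  assumes "finite I" "(\<Union>i\<in>I. {l i..r i}) = {p..q}" "p \<le> x" "x < q"
  shows "\<exists>i\<in>I. l i \<le> x \<and> x < r i"
proof (rule ccontr)
  assume no: "\<not> ?thesis"
  define M where "M = Min (insert q {l i |i. i \<in> I \<and> l i > x})"
  have fin: "finite (insert q {l i |i. i \<in> I \<and> l i > x})" using assms(1) by auto
  have "x < M" unfolding M_def using fin assms(4) by (subst Min_gr_iff) auto
  then obtain y where y: "x < y" "y < M" using dense by blast
  have "M \<le> q" unfolding M_def using fin by (intro Min_le) auto
  then have "y \<in> {p..q}" using y assms by auto
  then obtain i where i: "i \<in> I" "l i \<le> y" "y \<le> r i" unfolding assms(2)[symmetric] by auto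
  have "l i \<le> x"
  proof (rule ccontr)
    assume "\<not> l i \<le> x"
    then have "M \<le> l i" unfolding M_def using fin i by (intro Min_le) auto
    then show False using i y by auto
  qed
  then show False using no i y by force
qed

text \<open>Used both for lengths along a side and for angles at a point. Two of the intervals
  overlap at most in their four endpoints, so the overlaps are negligible; degenerate intervals are
  allowed.\<close>

lemma interval_tiling_sum:
  fixes l r :: "'a \<Rightarrow> real"
  assumes "finite I" "(\<Union>i\<in>I. {l i..r i}) = {p..q}" "p \<le> q" "\<And>i. i \<in> I \<Longrightarrow> l i \<le> r i"
    and dis: "\<And>i j. i \<in> I \<Longrightarrow> j \<in> I \<Longrightarrow> i \<noteq> j \<Longrightarrow> {l i<..<r i} \<inter> {l j<..<r j} = {}"
  shows "(\<Sum>i\<in>I. r i - l i) = q - p"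
proof -
  have "measure lebesgue (\<Union>((\<lambda>i. {l i..r i}) ` I)) = (\<Sum>i\<in>I. measure lebesgue {l i..r i})"
  proof (rule measure_negligible_finite_Union_image)
    show "pairwise (\<lambda>i j. negligible ({l i..r i} \<inter> {l j..r j})) I"
    proof (rule pairwiseI)
      fix i j assume "i \<in> I" "j \<in> I" "i \<noteq> j"
      then have "{l i..r i} \<inter> {l j..r j} \<subseteq> {l i, r i, l j, r j}" using dis[of i j] by fastforce
      then show "negligible ({l i..r i} \<inter> {l j..r j})"
        by (meson finite.emptyI finite.insertI finite_subset negligible_finite)
    qed
  qed (use assms(1) in auto)
  then show ?thesis using assms by simp
qed

text \<open>The intervals of positive length outnumber the interior division points by one.
  Concretely, the interval starting at \<open>p\<close> must mark its right end; take the rightmost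
  one that does so. The next interval starts at that marked point and cannot mark its right end, so
  it marks the same point.\<close>

lemma interval_tiling_pigeonhole:
  fixes l r m :: "'a \<Rightarrow> real"
  assumes "finite I" "(\<Union>i\<in>I. {l i..r i}) = {p..q}" "p < q"
    and dis: "\<And>i j. i \<in> I \<Longrightarrow> j \<in> I \<Longrightarrow> i \<noteq> j \<Longrightarrow> {l i<..<r i} \<inter> {l j<..<r j} = {}"
    and m: "\<And>i. i \<in> I \<Longrightarrow> l i < r i \<Longrightarrow> m i \<in> {l i, r i} - {p, q}"
  obtains i j where "i \<in> I" "j \<in> I" "l i < r i" "l j < r j" "i \<noteq> j" "m i = m j"
proof -
  define R where "R = {i \<in> I. l i < r i \<and> m i = r i}"
  obtain i0 where i0: "i0 \<in> I" "l i0 \<le> p" "p < r i0"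
    using interval_cover_right[OF assms(1,2), of p] assms(3) by auto
  have "{l i..r i} \<subseteq> {p..q}" if "i \<in> I" for i using assms(2) that by blast
  then have bd: "p \<le> l i \<and> r i \<le> q" if "i \<in> I" "l i \<le> r i" for i using that by fastforce
  have "i0 \<in> R" using i0 bd[of i0] m[of i0] by (auto simp: R_def)
  moreover have "finite R" using assms(1) by (auto simp: R_def)
  ultimately obtain i where i: "i \<in> R" "\<And>j. j \<in> R \<Longrightarrow> r j \<le> r i"
    using obtains_MAX[of R r] by (metis Max_ge empty_iff finite_imageI imageI)
  have iI: "i \<in> I" "l i < r i" "m i = r i" using i by (auto simp: R_def)
  then have ri: "r i < q" "p \<le> r i" using m[of i] bd[of i] by force+
  obtain j where j: "j \<in> I" "l j \<le> r i" "r i < r j"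
    using interval_cover_right[OF assms(1,2), of "r i"] ri by auto
  have "l j = r i"
  proof (rule ccontr)
    assume "l j \<noteq> r i"
    then have "(max (l i) (l j) + r i) / 2 \<in> {l i<..<r i} \<inter> {l j<..<r j}" using j iI by auto
    moreover have "i \<noteq> j" using j by auto
    ultimately show False using dis[of i j] iI j by blast
  qed
  moreover have "j \<notin> R" using i(2)[of j] j by auto
  ultimately have "m j = l j" using m[of j] j by (auto simp: R_def)
  then show ?thesis using that[of i j] j iI \<open>l j = r i\<close> by auto
qed

section \<open>Directions at a point\<close>

lemma angle_commute: "angle X Y Z = angle Z Y X"
  by (simp add: angle_def inner_commute mult.commute)

text \<open>Tiles are unordered sets, and sums over the tiles at a point need an angle that depends
  only on the tile and the point. The choice is harmless because \<open>angle\<close> is symmetric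
  in its outer arguments.\<close>

definition vangle :: "point set \<Rightarrow> point \<Rightarrow> real" where
  "vangle U P = (SOME t. \<exists>Q R. U = {P, Q, R} \<and> t = angle Q P R)"

lemma vangle_eq:
  assumes "U = {P, Q, R}" "card U = 3"
  shows "vangle U P = angle Q P R"
  unfolding vangle_def
proof (rule some_equality)
  fix t assume "\<exists>Q' R'. U = {P, Q', R'} \<and> t = angle Q' P R'"
  then obtain Q' R' where *: "U = {P, Q', R'}" "t = angle Q' P R'" by blast
  have "P \<noteq> Q" "P \<noteq> R" "Q \<noteq> R" using assms by (auto simp: card_insert_if split: if_splits)
  moreover have "P \<noteq> Q'" "P \<noteq> R'" "Q' \<noteq> R'" using assms(2) * by (auto simp: card_insert_if split: if_splits)
  ultimately have "Q' = Q \<and> R' = R \<or> Q' = R \<and> R' = Q" using assms(1) *(1) by (auto simp: set_eq_iff)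
  then show "t = angle Q P R" using *(2) angle_commute by blast
qed (use assms in blast)

lemma triangle_vertices:
  assumes "card U = 3" "P \<in> U"
  obtains Q R where "U = {P, Q, R}" "P \<noteq> Q" "P \<noteq> R" "Q \<noteq> R"
proof -
  have "card (U - {P}) = 2" using assms by (simp add: card_Diff_singleton_if)
  then obtain Q R where "U - {P} = {Q, R}" "Q \<noteq> R" by (auto simp: card_2_iff)
  then show ?thesis using that[of Q R] assms(2) by blast
qed

text \<open>At a boundary point of the tiled triangle, the directions into it are parametrised by an
  interval of angles, which the feasible directions of the tiles cut into subintervals.\<close>

definition feasible :: "'a::real_vector set \<Rightarrow> 'a \<Rightarrow> 'a \<Rightarrow> bool" where
  "feasible K P d \<longleftrightarrow> (\<exists>\<delta>>0. P + \<delta> *\<^sub>R d \<in> K)"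

lemma feasible_vertex: "Q \<in> K \<Longrightarrow> feasible K P (Q - P)"
  unfolding feasible_def by (rule exI[of _ 1]) auto

lemma feasible_scale:
  assumes "feasible K P d" "P \<in> K" "c \<ge> 0"
  shows "feasible K P (c *\<^sub>R d)"
proof (cases "c = 0")
  case False
  obtain \<delta> where "\<delta> > 0" "P + \<delta> *\<^sub>R d \<in> K" using assms(1) by (auto simp: feasible_def)
  then show ?thesis unfolding feasible_def using False assms(3) by (intro exI[of _ "\<delta> / c"]) auto
qed (use assms in \<open>auto simp: feasible_def intro: exI[of _ 1]\<close>)

lemma feasible_add:
  assumes "convex K" "feasible K P d" "feasible K P e"
  shows "feasible K P (d + e)"
proof -
  obtain \<delta> \<epsilon> where *: "\<delta> > 0" "P + \<delta> *\<^sub>R d \<in> K" "\<epsilon> > 0" "P + \<epsilon> *\<^sub>R e \<in> K"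
    using assms(2,3) by (auto simp: feasible_def)
  \<comment> \<open>The weights are chosen so that \<open>d\<close> and \<open>e\<close> receive the
    same coefficient.\<close>
  have "(\<epsilon> / (\<delta> + \<epsilon>)) *\<^sub>R (P + \<delta> *\<^sub>R d) + (\<delta> / (\<delta> + \<epsilon>)) *\<^sub>R (P + \<epsilon> *\<^sub>R e) \<in> K"
    using * by (intro convexD[OF assms(1)]) (auto simp flip: add_divide_distrib)
  also have "(\<epsilon> / (\<delta> + \<epsilon>)) *\<^sub>R (P + \<delta> *\<^sub>R d) + (\<delta> / (\<delta> + \<epsilon>)) *\<^sub>R (P + \<epsilon> *\<^sub>R e)
     = (\<epsilon> / (\<delta> + \<epsilon>) + \<delta> / (\<delta> + \<epsilon>)) *\<^sub>R P + (\<delta> * \<epsilon> / (\<delta> + \<epsilon>)) *\<^sub>R (d + e)"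
    by (simp add: algebra_simps)
  also have "\<epsilon> / (\<delta> + \<epsilon>) + \<delta> / (\<delta> + \<epsilon>) = 1" using * by (simp flip: add_divide_distrib)
  finally show ?thesis unfolding feasible_def using * by (intro exI[of _ "\<delta> * \<epsilon> / (\<delta> + \<epsilon>)"]) auto
qed

lemma feasible_shrink:
  assumes "convex K" "P \<in> K" "P + \<delta> *\<^sub>R d \<in> K" "0 < \<epsilon>" "\<epsilon> \<le> \<delta>"
  shows "P + \<epsilon> *\<^sub>R d \<in> K"
proof -
  have "(1 - \<epsilon> / \<delta>) *\<^sub>R P + (\<epsilon> / \<delta>) *\<^sub>R (P + \<delta> *\<^sub>R d) \<in> K"
    using assms by (intro convexD) (auto simp: field_simps)
  also have "(1 - \<epsilon> / \<delta>) *\<^sub>R P + (\<epsilon> / \<delta>) *\<^sub>R (P + \<delta> *\<^sub>R d) = P + \<epsilon> *\<^sub>R d"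
    using assms by (simp add: algebra_simps)
  finally show ?thesis .
qed

text \<open>One witness and convexity give all smaller steps. As a filter statement, this lets
  several directions and several tiles share one step length.\<close>

lemma feasible_eventually:
  assumes "convex K" "P \<in> K" "feasible K P d"
  shows "\<forall>\<^sub>F \<delta> in at_right 0. P + \<delta> *\<^sub>R d \<in> K"
proof -
  obtain \<delta> where "\<delta> > 0" "P + \<delta> *\<^sub>R d \<in> K" using assms(3) by (auto simp: feasible_def)
  then show ?thesis using feasible_shrink[OF assms(1,2)]
    unfolding eventually_at_right_field by (intro exI[of _ \<delta>]) auto
qed

lemma feasible_triangle:
  "feasible (convex hull {P, Q, R}) P d \<longleftrightarrow> (\<exists>\<kappa>\<ge>0. \<exists>\<mu>\<ge>0. d = \<kappa> *\<^sub>R (Q - P) + \<mu> *\<^sub>R (R - P))"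
proof
  assume "feasible (convex hull {P, Q, R}) P d"
  then obtain \<delta> a b c where *: "\<delta> > 0" "0 \<le> a" "0 \<le> b" "0 \<le> c" "a + b + c = 1"
      "P + \<delta> *\<^sub>R d = a *\<^sub>R P + b *\<^sub>R Q + c *\<^sub>R R"
    by (auto simp: feasible_def convex_hull_3)
  have a: "a = 1 - b - c" using * by simp
  have "\<delta> *\<^sub>R d = b *\<^sub>R (Q - P) + c *\<^sub>R (R - P)" using *(6) unfolding a by (simp add: algebra_simps)
  then have "(1 / \<delta>) *\<^sub>R (\<delta> *\<^sub>R d) = (1 / \<delta>) *\<^sub>R (b *\<^sub>R (Q - P) + c *\<^sub>R (R - P))" by simp
  then have "d = (b / \<delta>) *\<^sub>R (Q - P) + (c / \<delta>) *\<^sub>R (R - P)" using *(1) by (simp add: scaleR_add_right)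
  then show "\<exists>\<kappa>\<ge>0. \<exists>\<mu>\<ge>0. d = \<kappa> *\<^sub>R (Q - P) + \<mu> *\<^sub>R (R - P)" using *
    by (intro exI[of _ "b / \<delta>"] exI[of _ "c / \<delta>"] conjI) auto
next
  assume "\<exists>\<kappa>\<ge>0. \<exists>\<mu>\<ge>0. d = \<kappa> *\<^sub>R (Q - P) + \<mu> *\<^sub>R (R - P)"
  then obtain \<kappa> \<mu> where "\<kappa> \<ge> 0" "\<mu> \<ge> 0" "d = \<kappa> *\<^sub>R (Q - P) + \<mu> *\<^sub>R (R - P)" by blast
  moreover have "P \<in> convex hull {P, Q, R}" "Q \<in> convex hull {P, Q, R}" "R \<in> convex hull {P, Q, R}"
    by (auto intro: hull_inc)
  ultimately show "feasible (convex hull {P, Q, R}) P d"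
    by (auto intro!: feasible_add feasible_scale feasible_vertex)
qed

lemma noncollinear_triangle_interior:
  fixes p q r :: point
  assumes "\<not> collinear {p, q, r}"
  shows "interior (convex hull {p, q, r}) \<noteq> {}"
proof -
  have "\<not> affine_dependent {p, q, r}" and "card {p, q, r} = Suc (DIM(point))"
    using assms by (auto simp: collinear_3_eq_affine_dependent)
  then show ?thesis using interior_convex_hull_eq_empty by blast
qed

text \<open>A nondegenerate triangle of common points would lie in both sets and have interior
  points. Disjointness of the interiors of tiles enters the geometry along a side in this
  form.\<close>

lemma collinear_inter_convex:
  fixes K L :: "point set"
  assumes "convex K" "convex L" "interior K \<inter> interior L = {}" "{p, q, r} \<subseteq> K \<inter> L"
  shows "collinear {p, q, r}"
proof (rule ccontr)
  assume "\<not> collinear {p, q, r}"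
  then have "interior (convex hull {p, q, r}) \<noteq> {}" by (rule noncollinear_triangle_interior)
  moreover have "convex hull {p, q, r} \<subseteq> K" "convex hull {p, q, r} \<subseteq> L"
    using assms by (simp_all add: subset_hull)
  ultimately show False using assms(3) interior_mono by blast
qed

lemma collinear_shift: "collinear {P, Q, R} \<longleftrightarrow> collinear {0, Q - P, R - P}"
proof -
  have "collinear {P, Q, R} \<longleftrightarrow> collinear {Q, P, R}" by (simp add: insert_commute)
  also have "\<dots> \<longleftrightarrow> collinear {0, Q - P, R - P}"
    by (cases "Q = 0") (use collinear_3[of Q P R] in \<open>auto simp: NO_MATCH_def\<close>)
  finally show ?thesis .
qed

text \<open>An orthonormal frame; later \<open>u\<close> points along a side of the tiled triangle and \<open>n\<close> to its inner side.\<close>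

locale chart =
  fixes u n :: point
  assumes nu[simp]: "u \<bullet> u = 1" and nn[simp]: "n \<bullet> n = 1" and un[simp]: "u \<bullet> n = 0"
begin

lemma nu'[simp]: "n \<bullet> u = 0" by (metis un inner_commute)

lemma decomp: "v = (v \<bullet> u) *\<^sub>R u + (v \<bullet> n) *\<^sub>R n"
proof -
  define w where "w = v - (v \<bullet> u) *\<^sub>R u - (v \<bullet> n) *\<^sub>R n"
  have w: "w \<bullet> u = 0" "w \<bullet> n = 0" by (simp_all add: w_def algebra_simps)
  have *: "w$1 * u$1 + w$2 * u$2 = 0" "w$1 * n$1 + w$2 * n$2 = 0" "u$1 * n$1 + u$2 * n$2 = 0"
    "u$1 * u$1 + u$2 * u$2 = 1" "n$1 * n$1 + n$2 * n$2 = 1"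
    using w nu nn un by (simp_all add: inner_vec_def sum_2)
  \<comment> \<open>The determinant of the frame. Its square is 1 by Lagrange's identity, and
    Cramer's rule then gives \<open>w = 0\<close>.\<close>
  define d where "d = u$1 * n$2 - u$2 * n$1"
  have "d\<^sup>2 = (u$1 * u$1 + u$2 * u$2) * (n$1 * n$1 + n$2 * n$2) - (u$1 * n$1 + u$2 * n$2)\<^sup>2"
    by (simp add: d_def algebra_simps power2_eq_square)
  then have "d \<noteq> 0" unfolding * by auto
  moreover have "w$1 * d = (w$1 * u$1 + w$2 * u$2) * n$2 - (w$1 * n$1 + w$2 * n$2) * u$2"
    "w$2 * d = (w$1 * n$1 + w$2 * n$2) * u$1 - (w$1 * u$1 + w$2 * u$2) * n$1"
    by (simp_all add: d_def algebra_simps)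
  then have "w$1 * d = 0" "w$2 * d = 0" unfolding * by simp_all
  ultimately have "w$1 = 0 \<and> w$2 = 0" by simp
  then have "w = 0" by (simp add: vec_eq_iff forall_2)
  then show ?thesis by (simp add: w_def algebra_simps)
qed

definition e :: "real \<Rightarrow> point" where "e t = cos t *\<^sub>R u + sin t *\<^sub>R n"

lemma e_inner[simp]: "e t \<bullet> u = cos t" "e t \<bullet> n = sin t" "u \<bullet> e t = cos t" "n \<bullet> e t = sin t"
  by (simp_all add: e_def algebra_simps)

lemma e_e: "e s \<bullet> e t = cos (s - t)"
  by (simp add: e_def[of s] inner_add_left cos_diff)

lemma norm_e[simp]: "norm (e t) = 1"
  by (simp add: norm_eq_sqrt_inner e_e)

lemma polar:
  assumes "v \<noteq> 0" "v \<bullet> n \<ge> 0"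
  obtains t r where "0 \<le> t" "t \<le> pi" "r > 0" "v = r *\<^sub>R e t"
proof -
  define r where "r = norm v"
  have r: "r > 0" using assms by (simp add: r_def)
  have "v \<bullet> v = (v \<bullet> u)\<^sup>2 + (v \<bullet> n)\<^sup>2"
    by (subst (2) decomp) (simp add: inner_add_right power2_eq_square)
  then have "r\<^sup>2 = (v \<bullet> u)\<^sup>2 + (v \<bullet> n)\<^sup>2" by (simp add: r_def power2_norm_eq_inner)
  then have "((v \<bullet> u)\<^sup>2 + (v \<bullet> n)\<^sup>2) / r\<^sup>2 = 1" using r by (metis divide_self less_irrefl zero_less_power)
  then have "((v \<bullet> u) / r)\<^sup>2 + ((v \<bullet> n) / r)\<^sup>2 = 1" by (simp add: power_divide add_divide_distrib)
  then obtain t where t: "0 \<le> t" "t \<le> pi" "(v \<bullet> u) / r = cos t" "(v \<bullet> n) / r = sin t"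
    using sincos_total_pi[of "(v \<bullet> n) / r" "(v \<bullet> u) / r"] assms r by auto
  then have "v \<bullet> u = r * cos t" "v \<bullet> n = r * sin t" using r by (auto simp: field_simps)
  then have "v = r *\<^sub>R e t" by (subst decomp) (simp add: e_def scaleR_add_right)
  then show ?thesis using that t r by blast
qed

lemma angle_e:
  assumes "q > 0" "r > 0" "\<bar>s - t\<bar> \<le> pi"
  shows "angle (P + q *\<^sub>R e s) P (P + r *\<^sub>R e t) = \<bar>s - t\<bar>"
proof -
  have "angle (P + q *\<^sub>R e s) P (P + r *\<^sub>R e t) = arccos (cos (s - t))"
    using assms by (simp add: angle_def e_e)
  also have "cos (s - t) = cos \<bar>s - t\<bar>" by simp
  also have "arccos \<dots> = \<bar>s - t\<bar>" using assms by (intro arccos_cos) auto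
  finally show ?thesis .
qed

text \<open>Cramer's rule in the oblique basis \<open>e t1\<close>, \<open>e t2\<close>: the
  determinant of \<open>e x\<close> and \<open>e y\<close> is \<open>sin (y - x)\<close>.\<close>

lemma sin_comb:
  assumes "e t = a *\<^sub>R e t1 + b *\<^sub>R e t2"
  shows "sin (t - t1) = b * sin (t2 - t1)" "sin (t2 - t) = a * sin (t2 - t1)"
proof -
  have "cos t = a * cos t1 + b * cos t2" "sin t = a * sin t1 + b * sin t2"
    using arg_cong[OF assms, of "\<lambda>v. v \<bullet> u"] arg_cong[OF assms, of "\<lambda>v. v \<bullet> n"]
    by (simp_all add: inner_add_left)
  then show "sin (t - t1) = b * sin (t2 - t1)" "sin (t2 - t) = a * sin (t2 - t1)"
    by (simp_all add: sin_diff algebra_simps)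
qed

lemma noncollinear_e:
  assumes "q \<noteq> 0" "r \<noteq> 0" "sin (t - s) \<noteq> 0"
  shows "\<not> collinear {P, P + q *\<^sub>R e s, P + r *\<^sub>R e t}"
proof
  assume "collinear {P, P + q *\<^sub>R e s, P + r *\<^sub>R e t}"
  then have "collinear {0, q *\<^sub>R e s, r *\<^sub>R e t}" by (subst (asm) collinear_shift) (simp only: add_diff_cancel_left')
  moreover have "e s \<noteq> 0" "e t \<noteq> 0" using norm_e[of s] norm_e[of t] by fastforce+
  ultimately obtain c where "r *\<^sub>R e t = c *\<^sub>R q *\<^sub>R e s" using assms by (auto simp: collinear_lemma)
  then have "(1 / r) *\<^sub>R (r *\<^sub>R e t) = (1 / r) *\<^sub>R (c *\<^sub>R q *\<^sub>R e s)" by simp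
  then have "e t = (c * q / r) *\<^sub>R e s + 0 *\<^sub>R e s" using assms by simp
  from sin_comb(1)[OF this] assms(3) show False by simp
qed

text \<open>By \<open>sin_comb\<close>, the coefficients have the signs of
  \<open>sin (t2 - t)\<close> and \<open>sin (t - t1)\<close>. On the half circle these signs decide
  the order of the angles.\<close>

lemma sector:
  assumes "q > 0" "r > 0" "0 \<le> t1" "t1 < t2" "t2 \<le> pi" "t2 - t1 < pi" "0 \<le> t" "t \<le> pi"
  shows "(\<exists>a\<ge>0. \<exists>b\<ge>0. e t = a *\<^sub>R (q *\<^sub>R e t1) + b *\<^sub>R (r *\<^sub>R e t2)) \<longleftrightarrow> t1 \<le> t \<and> t \<le> t2"
proof
  assume "\<exists>a\<ge>0. \<exists>b\<ge>0. e t = a *\<^sub>R (q *\<^sub>R e t1) + b *\<^sub>R (r *\<^sub>R e t2)"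
  then obtain a b where ab: "a \<ge> 0" "b \<ge> 0" "e t = (a * q) *\<^sub>R e t1 + (b * r) *\<^sub>R e t2" by auto
  have "sin (t2 - t1) > 0" using assms by (intro sin_gt_zero) auto
  then have *: "sin (t - t1) \<ge> 0" "sin (t2 - t) \<ge> 0" using sin_comb[OF ab(3)] ab assms by simp_all
  have "t1 \<le> t"
  proof (rule ccontr)
    assume "\<not> t1 \<le> t"
    moreover have "sin (t1 - t) \<le> 0" using *(1) sin_minus[of "t - t1"] by simp
    ultimately show False using sin_gt_zero[of "t1 - t"] assms by linarith
  qed
  moreover have "t \<le> t2"
  proof (rule ccontr)
    assume "\<not> t \<le> t2"
    moreover have "sin (t - t2) \<le> 0" using *(2) sin_minus[of "t2 - t"] by simp
    ultimately show False using sin_gt_zero[of "t - t2"] assms by linarith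
  qed
  ultimately show "t1 \<le> t \<and> t \<le> t2" ..
next
  assume t: "t1 \<le> t \<and> t \<le> t2"
  define S where "S = sin (t2 - t1)"
  have S: "S > 0" unfolding S_def using assms by (intro sin_gt_zero) auto
  have c: "S * cos t = sin (t2 - t) * cos t1 + sin (t - t1) * cos t2"
    by (simp add: S_def sin_diff algebra_simps)
  have s: "S * sin t = sin (t2 - t) * sin t1 + sin (t - t1) * sin t2"
    by (simp add: S_def sin_diff algebra_simps)
  have "cos t = (sin (t2 - t) / S) * cos t1 + (sin (t - t1) / S) * cos t2"
    "sin t = (sin (t2 - t) / S) * sin t1 + (sin (t - t1) / S) * sin t2"
    using c s S by (simp_all add: field_simps)
  then have "e t = (sin (t2 - t) / S) *\<^sub>R e t1 + (sin (t - t1) / S) *\<^sub>R e t2"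
    by (simp add: e_def scaleR_add_left scaleR_add_right)
  also have "\<dots> = (sin (t2 - t) / S / q) *\<^sub>R (q *\<^sub>R e t1) + (sin (t - t1) / S / r) *\<^sub>R (r *\<^sub>R e t2)"
    using assms by simp
  finally have "e t = \<dots>" .
  moreover have "sin (t2 - t) \<ge> 0" "sin (t - t1) \<ge> 0" using assms t by (auto intro!: sin_ge_zero)
  ultimately show "\<exists>a\<ge>0. \<exists>b\<ge>0. e t = a *\<^sub>R (q *\<^sub>R e t1) + b *\<^sub>R (r *\<^sub>R e t2)"
    using S assms by (meson divide_nonneg_pos)
qed

lemma vertex_sector:
  assumes "U = {P, Q, R}" "\<not> collinear U" "card U = 3" "(Q - P) \<bullet> n \<ge> 0" "(R - P) \<bullet> n \<ge> 0"
  obtains t1 t2 where "0 \<le> t1" "t1 < t2" "t2 \<le> pi" "t2 - t1 = vangle U P"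
    "{t \<in> {0..pi}. feasible (convex hull U) P (e t)} = {t1..t2}"
proof -
  note result = that
  have ne: "Q \<noteq> P" "R \<noteq> P" using assms by (auto simp: card_insert_if split: if_splits)
  have wlog: thesis if Q: "Q = P + q *\<^sub>R e s" "q > 0" "0 \<le> s" and R: "R = P + r *\<^sub>R e t" "r > 0" "t \<le> pi"
      and U: "U = {P, Q, R}" and "s \<le> t"  for Q R q r s t
  proof -
    have "s \<noteq> t \<and> \<not> (s = 0 \<and> t = pi)"
    proof (rule ccontr)
      assume "\<not> ?thesis"
      then have "e t = e s \<or> e t = - e s" by (auto simp: e_def)
      then have "\<exists>c. r *\<^sub>R e t = c *\<^sub>R q *\<^sub>R e s"
        using Q(2) by (auto intro: exI[of _ "r / q"] exI[of _ "- r / q"])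
      then have "collinear {0, q *\<^sub>R e s, r *\<^sub>R e t}" unfolding collinear_lemma by blast
      then have "collinear {P, Q, R}" by (subst collinear_shift) (simp only: Q R add_diff_cancel_left')
      then show False using assms(2) U by simp
    qed
    then have st: "s < t" "t - s < pi" using \<open>s \<le> t\<close> Q R by linarith+
    have "vangle U P = angle Q P R" using vangle_eq[OF U] assms(3) by simp
    also have "\<dots> = t - s" unfolding Q R using angle_e[of q r s t P] Q R st by auto
    finally have "t - s = vangle U P" ..
    moreover have "feasible (convex hull U) P (e \<tau>) \<longleftrightarrow> s \<le> \<tau> \<and> \<tau> \<le> t" if "0 \<le> \<tau>" "\<tau> \<le> pi" for \<tau>
      unfolding U feasible_triangle sector[OF Q(2) R(2) Q(3) st(1) R(3) st(2) that, symmetric]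
      unfolding Q(1) R(1) add_diff_cancel_left' ..
    then have "{\<tau> \<in> {0..pi}. feasible (convex hull U) P (e \<tau>)} = {s..t}"
      using Q R st by auto
    ultimately show thesis using result[of s t] st Q R by auto
  qed
  obtain s q where "0 \<le> s" "s \<le> pi" "q > 0" "Q - P = q *\<^sub>R e s" using polar[of "Q - P"] ne assms by auto
  moreover obtain t r where "0 \<le> t" "t \<le> pi" "r > 0" "R - P = r *\<^sub>R e t" using polar[of "R - P"] ne assms by auto
  moreover have "Q = P + (Q - P)" "R = P + (R - P)" by simp_all
  ultimately have "Q = P + q *\<^sub>R e s" "R = P + r *\<^sub>R e t" "0 \<le> s" "s \<le> pi" "q > 0"  "0 \<le> t" "t \<le> pi" "r > 0" by simp_all
  moreover have "U = {P, R, Q}" using assms(1) by (simp add: insert_commute)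
  ultimately show thesis using wlog[of Q q s R r t] wlog[of R r t Q q s] assms(1) by linarith
qed

text \<open>Inside an edge both \<open>u\<close> and \<open>- u\<close> are feasible. Together with
  one point strictly above the line they generate the closed upper half-plane.\<close>

lemma edge_sector:
  assumes "convex K" "P \<in> K" "P + a *\<^sub>R u \<in> K" "P - b *\<^sub>R u \<in> K" "a > 0" "b > 0" "w \<in> K" "(w - P) \<bullet> n > 0"
    "0 \<le> t" "t \<le> pi"
  shows "feasible K P (e t)"
proof -
  have fu: "feasible K P (c *\<^sub>R u)" for c
  proof (cases "c \<ge> 0")
    case True
    then show ?thesis using feasible_scale[of K P "a *\<^sub>R u" "c / a"] feasible_vertex[OF assms(3), of P] assms by simp
  next
    case False
    then show ?thesis using feasible_scale[of K P "- b *\<^sub>R u" "- c / b"] feasible_vertex[OF assms(4), of P] assms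
      by (simp add: divide_nonpos_nonneg)
  qed
  define y where "y = (w - P) \<bullet> n"
  define x where "x = (w - P) \<bullet> u"
  have y: "y > 0" using assms(8) by (simp add: y_def)
  have "w - P = x *\<^sub>R u + y *\<^sub>R n" unfolding x_def y_def by (rule decomp)
  then have "(sin t / y) *\<^sub>R (w - P) = (sin t / y * x) *\<^sub>R u + sin t *\<^sub>R n"
    using y by (simp add: scaleR_add_right)
  then have "e t = (sin t / y) *\<^sub>R (w - P) + (cos t - sin t / y * x) *\<^sub>R u"
    by (simp add: e_def algebra_simps)
  moreover have "sin t / y \<ge> 0" using assms sin_ge_zero[of t] by (simp add: y_def)
  ultimately show ?thesis
    using feasible_add[OF assms(1)] feasible_scale feasible_vertex[OF assms(7)] fu assms(2) by metis
qed

lemma upper_vertex: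
  assumes "\<not> collinear U" "\<And>Q. Q \<in> U \<Longrightarrow> (Q - P) \<bullet> n \<ge> 0"
  obtains W where "W \<in> U" "(W - P) \<bullet> n > 0"
proof (rule ccontr)
  assume "\<not> thesis"
  then have 0: "(Q - P) \<bullet> n = 0" if "Q \<in> U" for Q using assms(2) that \<open>\<And>W. _ \<Longrightarrow> _ \<Longrightarrow> thesis\<close> by fastforce
  have "collinear U" unfolding collinear_def
  proof (intro exI[of _ u] ballI)
    fix x y assume "x \<in> U" "y \<in> U"
    then have "(x - y) \<bullet> n = 0" using 0[of x] 0[of y] by (simp add: inner_diff_left)
    then show "\<exists>c. x - y = c *\<^sub>R u" using decomp[of "x - y"] by auto
  qed
  then show False using assms(1) by simp
qed

text \<open>\<open>P\<close> is a convex combination of vertices whose heights over the line through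
  \<open>P\<close> are nonnegative and average to zero. So the vertex \<open>W\<close> strictly
  above the line has weight zero, and \<open>P\<close> lies strictly between the other two.\<close>

lemma base_point:
  assumes U: "card U = 3" "\<not> collinear U" and pos: "\<And>Q. Q \<in> U \<Longrightarrow> (Q - P) \<bullet> n \<ge> 0"
    and P: "P \<in> convex hull U" "P \<notin> U"
  obtains a b W where "a > 0" "b > 0" "P + a *\<^sub>R u \<in> U" "P - b *\<^sub>R u \<in> U" "W \<in> U" "(W - P) \<bullet> n > 0"
proof -
  obtain W where W: "W \<in> U" "(W - P) \<bullet> n > 0" using upper_vertex[OF U(2) pos] by auto
  obtain Q R where QR: "U = {W, Q, R}" "Q \<noteq> R" using triangle_vertices[OF U(1) W(1)] by metis
  then obtain \<kappa> \<mu> \<nu> where c: "0 \<le> \<kappa>" "0 \<le> \<mu>" "0 \<le> \<nu>" "\<kappa> + \<mu> + \<nu> = 1" "P = \<kappa> *\<^sub>R W + \<mu> *\<^sub>R Q + \<nu> *\<^sub>R R"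
    using P(1) by (auto simp: convex_hull_3)
  have "\<kappa> *\<^sub>R (W - P) + \<mu> *\<^sub>R (Q - P) + \<nu> *\<^sub>R (R - P) = P - (\<kappa> + \<mu> + \<nu>) *\<^sub>R P"
    unfolding right_diff_distrib scaleR_diff_right by (subst (4) c(5)) (simp add: algebra_simps)
  then have z: "\<kappa> *\<^sub>R (W - P) + \<mu> *\<^sub>R (Q - P) + \<nu> *\<^sub>R (R - P) = 0" using c(4) by simp
  have "\<kappa> * ((W - P) \<bullet> n) + \<mu> * ((Q - P) \<bullet> n) + \<nu> * ((R - P) \<bullet> n) = 0"
    using arg_cong[OF z, of "\<lambda>v. v \<bullet> n"] by (simp add: inner_add_left)
  moreover have "(Q - P) \<bullet> n \<ge> 0" "(R - P) \<bullet> n \<ge> 0" using pos QR by auto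
  ultimately have "\<kappa> * ((W - P) \<bullet> n) = 0" "\<mu> * ((Q - P) \<bullet> n) = 0" "\<nu> * ((R - P) \<bullet> n) = 0"
    using c W mult_nonneg_nonneg[of \<kappa> "(W - P) \<bullet> n"] mult_nonneg_nonneg[of \<mu> "(Q - P) \<bullet> n"]
      mult_nonneg_nonneg[of \<nu> "(R - P) \<bullet> n"] by linarith+
  then have "\<kappa> = 0" using W by simp
  have "\<mu> \<noteq> 0" "\<nu> \<noteq> 0" using c P QR \<open>\<kappa> = 0\<close> by auto
  then have n0: "(Q - P) \<bullet> n = 0" "(R - P) \<bullet> n = 0" using \<open>\<mu> * _ = 0\<close> \<open>\<nu> * _ = 0\<close> by auto
  define x y where "x = (Q - P) \<bullet> u" and "y = (R - P) \<bullet> u"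
  have x: "Q - P = x *\<^sub>R u" and y: "R - P = y *\<^sub>R u"
    using decomp[of "Q - P"] decomp[of "R - P"] n0 by (simp_all add: x_def y_def)
  have "\<mu> * x + \<nu> * y = 0"
    using arg_cong[OF z, of "\<lambda>v. v \<bullet> u"] \<open>\<kappa> = 0\<close> by (simp add: inner_add_left x_def y_def)
  moreover have "x \<noteq> 0" "y \<noteq> 0" using x y P QR by auto
  ultimately have "x > 0 \<and> y < 0 \<or> x < 0 \<and> y > 0"
    using \<open>\<mu> \<noteq> 0\<close> \<open>\<nu> \<noteq> 0\<close> c by (smt (verit) mult_pos_pos mult_pos_neg zero_less_mult_pos)
  moreover have "Q = P + x *\<^sub>R u" "R = P + y *\<^sub>R u" using x y by (simp_all add: algebra_simps flip: x y)
  ultimately show thesis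
    using that[of x "- y" W] that[of y "- x" W] QR W by fastforce
qed

end

lemma chart_exists:
  fixes A B C :: point
  assumes "\<not> collinear {A, B, C}"
  obtains u n where "chart u n" "B = A + dist A B *\<^sub>R u" "(C - A) \<bullet> n > 0"
proof -
  have ne: "A \<noteq> B" using assms by auto
  define u where "u = (1 / dist A B) *\<^sub>R (B - A)"
  \<comment> \<open>A quarter turn of \<open>u\<close>; the sign in \<open>n\<close> is then chosen
    so that \<open>C\<close> lies on the positive side.\<close>
  define m :: point where "m = vector [- u$2, u$1]"
  define n where "n = (if (C - A) \<bullet> m \<ge> 0 then m else - m)"
  have uu: "u \<bullet> u = 1" using ne unfolding u_def
    by (simp add: dist_norm norm_minus_commute power2_norm_eq_inner[symmetric] power2_eq_square)
  moreover have "m \<bullet> m = u \<bullet> u" "u \<bullet> m = 0" by (simp_all add: m_def inner_vec_def sum_2)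
  ultimately have ch: "chart u n" by unfold_locales (auto simp: n_def)
  have B: "B = A + dist A B *\<^sub>R u" using ne by (simp add: u_def)
  have "(C - A) \<bullet> n \<noteq> 0"
  proof
    assume "(C - A) \<bullet> n = 0"
    then have "C - A = ((C - A) \<bullet> u) *\<^sub>R u" using chart.decomp[OF ch, of "C - A"] by simp
    then have "C - A = ((C - A) \<bullet> u / dist A B) *\<^sub>R (B - A)" by (simp add: u_def)
    then have "collinear {0, B - A, C - A}" unfolding collinear_lemma by blast
    then show False using assms collinear_shift by blast
  qed
  moreover have "(C - A) \<bullet> n \<ge> 0" by (auto simp: n_def)
  ultimately show thesis using that[OF ch B] by linarith
qed

section \<open>Tiles along a side\<close>

text \<open>The tiles are arbitrary triangles here, since congruence only matters for the lengths
  and angles. Results are proved for the corner \<open>A\<close> and the side \<open>A B\<close>;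
  permuting the vertices gives the others.\<close>

locale triangle_tiling =
  fixes A B C :: point and \<T> :: "point set set"
  assumes noncollinear: "\<not> collinear {A, B, C}"
    and finite_tiles: "finite \<T>"
    and card_tile: "U \<in> \<T> \<Longrightarrow> card U = 3"
    and noncollinear_tile: "U \<in> \<T> \<Longrightarrow> \<not> collinear U"
    and interiors: "U \<in> \<T> \<Longrightarrow> W \<in> \<T> \<Longrightarrow> U \<noteq> W \<Longrightarrow> interior (convex hull U) \<inter> interior (convex hull W) = {}"
    and cover: "(\<Union>U\<in>\<T>. convex hull U) = convex hull {A, B, C}"
begin

text \<open>Includes the tiles that meet the side in one vertex only. They give degenerate
  intervals, and the tiles with an edge on the side are later singled out by the number of their
  vertices on it.\<close>

definition touching :: "point set set" where
  "touching = {U \<in> \<T>. convex hull U \<inter> closed_segment A B \<noteq> {}}"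

lemma hull_tile: "U \<in> \<T> \<Longrightarrow> convex hull U \<subseteq> convex hull {A, B, C}"
  using cover by blast

lemma tile_subset_hull: "U \<in> \<T> \<Longrightarrow> Q \<in> U \<Longrightarrow> Q \<in> convex hull {A, B, C}"
  by (rule subsetD[OF hull_tile hull_inc])

lemma compact_tile: "U \<in> \<T> \<Longrightarrow> compact (convex hull U)"
  using card_tile[of U] card.infinite[of U] by (intro finite_imp_compact_convex_hull) force

end

locale triangle_tiling_chart = triangle_tiling + chart +
  assumes base: "B = A + dist A B *\<^sub>R u" and apex: "(C - A) \<bullet> n > 0"
begin

abbreviation pt :: "real \<Rightarrow> point" where "pt t \<equiv> A + t *\<^sub>R u"

lemma L_pos: "dist A B > 0" using noncollinear by auto

lemma u_nonzero[simp]: "u \<noteq> 0" using nu by force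

lemma pt_inject: "pt s = pt t \<longleftrightarrow> s = t" by simp

lemma hull_coordinates:
  assumes "P \<in> convex hull {A, B, C}"
  shows "(P - A) \<bullet> n \<ge> 0" "(P - A) \<bullet> n = 0 \<Longrightarrow> \<exists>t\<in>{0..dist A B}. P = pt t"
proof -
  obtain a b c where c: "0 \<le> a" "0 \<le> b" "0 \<le> c" "a + b + c = 1" "P = a *\<^sub>R A + b *\<^sub>R B + c *\<^sub>R C"
    using assms by (auto simp: convex_hull_3)
  have a: "a = 1 - b - c" using c(4) by simp
  have P: "P - A = (b * dist A B) *\<^sub>R u + c *\<^sub>R (C - A)"
    unfolding c(5) a by (subst base) (simp add: algebra_simps)
  then have y: "(P - A) \<bullet> n = c * ((C - A) \<bullet> n)" by (simp add: inner_add_left)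
  then show "(P - A) \<bullet> n \<ge> 0" using c apex by simp
  assume "(P - A) \<bullet> n = 0"
  then have "c = 0" using y apex by simp
  then have "P = pt (b * dist A B)" using P by (simp add: algebra_simps)
  moreover have "b \<le> 1" using c by simp
  ultimately show "\<exists>t\<in>{0..dist A B}. P = pt t" using c L_pos
    by (intro bexI[of _ "b * dist A B"]) (auto intro: mult_left_le_one_le)
qed

lemma segment_pt: "closed_segment A B = pt ` {0..dist A B}"
proof (intro subset_antisym subsetI)
  fix P assume "P \<in> closed_segment A B"
  then obtain b where b: "0 \<le> b" "b \<le> 1" "P = (1 - b) *\<^sub>R A + b *\<^sub>R B" by (auto simp: closed_segment_def)
  then have "P = pt (b * dist A B)" by (subst (asm) base) (simp add: algebra_simps)
  then show "P \<in> pt ` {0..dist A B}" using b L_pos by (auto intro!: imageI mult_left_le_one_le)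
next
  fix P assume "P \<in> pt ` {0..dist A B}"
  then obtain t where t: "0 \<le> t" "t \<le> dist A B" "P = pt t" by auto
  have "P = (1 - t / dist A B) *\<^sub>R A + (t / dist A B) *\<^sub>R B"
    using t L_pos by (subst base) (simp add: algebra_simps)
  then show "P \<in> closed_segment A B" unfolding closed_segment_def using t L_pos
    by (auto intro!: exI[of _ "t / dist A B"])
qed

lemma segment_subset_hull: "closed_segment A B \<subseteq> convex hull {A, B, C}"
  unfolding segment_convex_hull by (intro hull_mono) auto

lemma pt_in_hull: "pt t \<in> convex hull {A, B, C} \<longleftrightarrow> 0 \<le> t \<and> t \<le> dist A B"
proof
  assume "pt t \<in> convex hull {A, B, C}"
  then show "0 \<le> t \<and> t \<le> dist A B" using hull_coordinates(2)[of "pt t"] pt_inject by auto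
next
  assume "0 \<le> t \<and> t \<le> dist A B"
  then show "pt t \<in> convex hull {A, B, C}" using segment_subset_hull segment_pt by fastforce
qed

lemma tile_above: "U \<in> \<T> \<Longrightarrow> Q \<in> U \<Longrightarrow> (Q - pt p) \<bullet> n \<ge> 0"
  using hull_coordinates(1)[OF tile_subset_hull, of U Q] by (simp add: inner_diff_left inner_add_left)

text \<open>For a small common step, the points reached from \<open>P\<close> in the two directions
  lie in both tiles. Since the directions differ by less than \<open>pi\<close>, they form a
  nondegenerate triangle with \<open>P\<close>.\<close>

lemma directions_disjoint:
  assumes "U \<in> \<T>" "W \<in> \<T>" "U \<noteq> W" "P \<in> convex hull U" "P \<in> convex hull W" "s < t" "t - s < pi"
    "feasible (convex hull U) P (e s)" "feasible (convex hull U) P (e t)"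
    "feasible (convex hull W) P (e s)" "feasible (convex hull W) P (e t)"
  shows False
proof -
  have "\<forall>\<^sub>F \<delta> in at_right 0. (P + \<delta> *\<^sub>R e s \<in> convex hull U \<inter> convex hull W \<and>
      P + \<delta> *\<^sub>R e t \<in> convex hull U \<inter> convex hull W) \<and> \<delta> > (0::real)"
    using assms unfolding Int_iff
    by (intro eventually_conj feasible_eventually convex_convex_hull) (auto simp: eventually_at_right_less)
  then obtain \<delta> where \<delta>: "\<delta> > 0" "P + \<delta> *\<^sub>R e s \<in> convex hull U \<inter> convex hull W"
      "P + \<delta> *\<^sub>R e t \<in> convex hull U \<inter> convex hull W"
    using eventually_happens'[OF trivial_limit_at_right_real] by blast
  then have "collinear {P, P + \<delta> *\<^sub>R e s, P + \<delta> *\<^sub>R e t}"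
    using collinear_inter_convex[OF _ _ interiors[OF assms(1-3)]] assms(4,5) convex_convex_hull by auto
  moreover have "sin (t - s) \<noteq> 0" using sin_gt_zero[of "t - s"] assms(6,7) by simp
  ultimately show False using noncollinear_e[of \<delta> \<delta> t s P] \<delta>(1) by auto
qed

lemma edge_directions:
  assumes "U \<in> \<T>" "pt l \<in> convex hull U" "pt r \<in> convex hull U" "l < p" "p < r" "0 \<le> t" "t \<le> pi"
  shows "pt p \<in> convex hull U" "feasible (convex hull U) (pt p) (e t)"
proof -
  have "((r - p) / (r - l)) *\<^sub>R pt l + ((p - l) / (r - l)) *\<^sub>R pt r \<in> convex hull U"
    using assms by (intro convexD[OF convex_convex_hull]) (auto simp flip: add_divide_distrib)
  also have "((r - p) / (r - l)) *\<^sub>R pt l + ((p - l) / (r - l)) *\<^sub>R pt r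
    = ((r - p) / (r - l) + (p - l) / (r - l)) *\<^sub>R A + ((r - p) / (r - l) * l + (p - l) / (r - l) * r) *\<^sub>R u"
    by (simp add: algebra_simps)
  also have "(r - p) / (r - l) + (p - l) / (r - l) = 1" using assms by (simp flip: add_divide_distrib)
  also have "(r - p) / (r - l) * l + (p - l) / (r - l) * r = p"
  proof -
    have "(r - p) / (r - l) * l + (p - l) / (r - l) * r = p * (r - l) / (r - l)"
      by (simp add: algebra_simps flip: add_divide_distrib diff_divide_distrib)
    then show ?thesis using assms by simp
  qed
  finally show p: "pt p \<in> convex hull U" by simp
  obtain W where "W \<in> U" "(W - pt p) \<bullet> n > 0"
    using upper_vertex[OF noncollinear_tile[OF assms(1)] tile_above[OF assms(1)]] by blast
  then show "feasible (convex hull U) (pt p) (e t)"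
    using assms p by (intro edge_sector[of _ _ "r - p" "p - l" W]) (auto simp: hull_inc algebra_simps)
qed

text \<open>The intersection is compact and convex, hence an interval. At an endpoint that is not a
  vertex, \<open>base_point\<close> would give points of the tile on both sides of it; and a vertex
  strictly between the endpoints would make the tile collinear. The case \<open>l = r\<close> is
  contact in a single vertex.\<close>

lemma side_interval:
  assumes U: "U \<in> \<T>" and ne: "convex hull U \<inter> closed_segment A B \<noteq> {}"
  obtains l r where "l \<le> r" "{t. pt t \<in> convex hull U} = {l..r}" "U \<inter> closed_segment A B = {pt l, pt r}"
    "0 \<le> l" "r \<le> dist A B"
proof -
  define Z where "Z = {t. pt t \<in> convex hull U}"
  have Zsub: "Z \<subseteq> {0..dist A B}" using hull_tile[OF U] pt_in_hull by (auto simp: Z_def)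
  have "closed ((\<lambda>t. pt t) -` (convex hull U))"
    using compact_imp_closed[OF compact_tile[OF U]] by (intro closed_vimage continuous_intros)
  then have "closed Z" by (simp add: Z_def vimage_def)
  then have "compact Z" using Zsub bounded_subset compact_eq_bounded_closed bounded_closed_interval by metis
  moreover have "convex Z"
  proof (rule convexI)
    fix s t a b :: real assume "s \<in> Z" "t \<in> Z" "0 \<le> a" "0 \<le> b" "a + b = 1"
    then have "a *\<^sub>R pt s + b *\<^sub>R pt t \<in> convex hull U"
      using convexD[OF convex_convex_hull] by (auto simp: Z_def)
    also have "a *\<^sub>R pt s + b *\<^sub>R pt t = (a + b) *\<^sub>R A + (a * s + b * t) *\<^sub>R u" by (simp add: algebra_simps)
    finally show "a *\<^sub>R s + b *\<^sub>R t \<in> Z" using \<open>a + b = 1\<close> by (simp add: Z_def)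
  qed
  ultimately obtain l r where lr: "Z = {l..r}"
    using connected_compact_interval_1 convex_connected by blast
  have "Z \<noteq> {}" using ne segment_pt by (auto simp: Z_def)
  then have "l \<le> r" using lr by simp
  have vert: "pt x \<in> U" if x: "x = l \<or> x = r" for x
  proof (rule ccontr)
    assume "pt x \<notin> U"
    moreover have "pt x \<in> convex hull U" using lr x \<open>l \<le> r\<close> Z_def by auto
    ultimately obtain a b where "a > 0" "b > 0" "pt x + a *\<^sub>R u \<in> U" "pt x - b *\<^sub>R u \<in> U"
      using base_point[OF card_tile[OF U] noncollinear_tile[OF U] tile_above[OF U], of x] by metis
    moreover have "pt x + a *\<^sub>R u = pt (x + a)" "pt x - b *\<^sub>R u = pt (x - b)" by (simp_all add: algebra_simps)
    ultimately have "x + a \<in> Z" "x - b \<in> Z" unfolding Z_def by (simp_all add: hull_inc)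
    then show False using lr x \<open>a > 0\<close> \<open>b > 0\<close> by auto
  qed
  have "U \<inter> closed_segment A B \<subseteq> {pt l, pt r}"
  proof
    fix P assume P: "P \<in> U \<inter> closed_segment A B"
    then obtain t where t: "P = pt t" using segment_pt by auto
    then have "t \<in> Z" using P by (simp add: Z_def hull_inc)
    show "P \<in> {pt l, pt r}"
    proof (rule ccontr)
      assume "P \<notin> {pt l, pt r}"
      then have *: "l < t" "t < r" using t \<open>t \<in> Z\<close> lr by (auto simp: order_less_le)
      have "card {P, pt l, pt r} = 3" using * t pt_inject by (simp add: card_insert_if)
      moreover have "{P, pt l, pt r} \<subseteq> U" using P vert by auto
      ultimately have "{P, pt l, pt r} = U"
        using card_tile[OF U] by (metis card.infinite card_subset_eq zero_neq_numeral)
      moreover have "collinear {P, pt l, pt r}"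
        unfolding collinear_def using t by (intro exI[of _ u]) (auto simp flip: scaleR_diff_left)
      ultimately show False using noncollinear_tile[OF U] by simp
    qed
  qed
  moreover have lr': "0 \<le> l \<and> r \<le> dist A B" using Zsub lr \<open>l \<le> r\<close> by simp
  moreover have "{pt l, pt r} \<subseteq> U \<inter> closed_segment A B"
    using vert lr' \<open>l \<le> r\<close> segment_pt by auto
  ultimately show thesis using that[of l r] \<open>l \<le> r\<close> lr unfolding Z_def by blast
qed

lemma side_intervals:
  obtains l r where
    "\<forall>U\<in>touching. l U \<le> r U \<and> U \<inter> closed_segment A B = {pt (l U), pt (r U)} \<and> 0 \<le> l U \<and> r U \<le> dist A B"
    "(\<Union>U\<in>touching. {l U..r U}) = {0..dist A B}"
    "\<forall>U\<in>touching. \<forall>W\<in>touching. U \<noteq> W \<longrightarrow> {l U<..<r U} \<inter> {l W<..<r W} = {}"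
proof -
  have "\<forall>U\<in>touching. \<exists>l r. l \<le> r \<and> {t. pt t \<in> convex hull U} = {l..r} \<and>
      U \<inter> closed_segment A B = {pt l, pt r} \<and> 0 \<le> l \<and> r \<le> dist A B"
  proof
    fix U assume "U \<in> touching"
    then have "U \<in> \<T>" "convex hull U \<inter> closed_segment A B \<noteq> {}" by (simp_all add: touching_def)
    then obtain l r where "l \<le> r" "{t. pt t \<in> convex hull U} = {l..r}" "U \<inter> closed_segment A B = {pt l, pt r}"
      "0 \<le> l" "r \<le> dist A B" by (rule side_interval)
    then show "\<exists>l r. l \<le> r \<and> {t. pt t \<in> convex hull U} = {l..r} \<and>
      U \<inter> closed_segment A B = {pt l, pt r} \<and> 0 \<le> l \<and> r \<le> dist A B" by (intro exI conjI)
  qed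
  from bchoice[OF this] obtain l where "\<forall>U\<in>touching. \<exists>r. l U \<le> r \<and> {t. pt t \<in> convex hull U} = {l U..r} \<and>
      U \<inter> closed_segment A B = {pt (l U), pt r} \<and> 0 \<le> l U \<and> r \<le> dist A B" ..
  from bchoice[OF this] obtain r where LR: "\<forall>U\<in>touching. l U \<le> r U \<and> {t. pt t \<in> convex hull U} = {l U..r U} \<and>
      U \<inter> closed_segment A B = {pt (l U), pt (r U)} \<and> 0 \<le> l U \<and> r U \<le> dist A B" ..
  have lr: "l U \<le> r U" "pt t \<in> convex hull U \<longleftrightarrow> t \<in> {l U..r U}" "0 \<le> l U" "r U \<le> dist A B"
    if "U \<in> touching" for U t
  proof -
    have *: "l U \<le> r U \<and> {t. pt t \<in> convex hull U} = {l U..r U} \<and>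
      U \<inter> closed_segment A B = {pt (l U), pt (r U)} \<and> 0 \<le> l U \<and> r U \<le> dist A B"
      using LR that by (rule bspec)
    then show "l U \<le> r U" "0 \<le> l U" "r U \<le> dist A B" by simp_all
    have "t \<in> {t. pt t \<in> convex hull U} \<longleftrightarrow> t \<in> {l U..r U}" using * by (simp only:)
    then show "pt t \<in> convex hull U \<longleftrightarrow> t \<in> {l U..r U}" by simp
  qed
  show thesis
  proof (rule that[of l r])
    show "\<forall>U\<in>touching. l U \<le> r U \<and> U \<inter> closed_segment A B = {pt (l U), pt (r U)} \<and> 0 \<le> l U \<and> r U \<le> dist A B"
    proof
      fix U assume "U \<in> touching"
      from bspec[OF LR this] show "l U \<le> r U \<and> U \<inter> closed_segment A B = {pt (l U), pt (r U)} \<and> 0 \<le> l U \<and> r U \<le> dist A B"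
        by (simp only: simp_thms)
    qed
  next
    show "(\<Union>U\<in>touching. {l U..r U}) = {0..dist A B}"
    proof (intro subset_antisym subsetI)
      fix t assume t: "t \<in> {0..dist A B}"
      then have "pt t \<in> closed_segment A B" using segment_pt by auto
      moreover from this obtain U where "U \<in> \<T>" "pt t \<in> convex hull U" using segment_subset_hull cover by blast
      ultimately have "U \<in> touching" by (auto simp: touching_def)
      then show "t \<in> (\<Union>U\<in>touching. {l U..r U})"
        using lr(2) \<open>pt t \<in> convex hull U\<close> by blast
    next
      fix t assume "t \<in> (\<Union>U\<in>touching. {l U..r U})"
      then obtain U where "U \<in> touching" "l U \<le> t" "t \<le> r U" by auto
      then show "t \<in> {0..dist A B}" using lr(3,4)[of U] by auto
    qed
  next
    show "\<forall>U\<in>touching. \<forall>W\<in>touching. U \<noteq> W \<longrightarrow> {l U<..<r U} \<inter> {l W<..<r W} = {}"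
    proof (intro ballI impI)
      fix U W assume *: "U \<in> touching" "W \<in> touching" "U \<noteq> W"
      then have **: "U \<in> \<T>" "W \<in> \<T>" by (simp_all add: touching_def)
      show "{l U<..<r U} \<inter> {l W<..<r W} = {}"
      proof (rule ccontr)
        assume "\<not> ?thesis"
        then obtain p where p: "l U < p" "p < r U" "l W < p" "p < r W" by (metis disjoint_iff greaterThanLessThan_iff)
        have U: "pt (l U) \<in> convex hull U" "pt (r U) \<in> convex hull U"
          using lr(1,2)[OF *(1)] by auto
        have W: "pt (l W) \<in> convex hull W" "pt (r W) \<in> convex hull W"
          using lr(1,2)[OF *(2)] by auto
        \<comment> \<open>Inside an edge every direction of the half-plane is feasible, so 0 and
          \<open>pi / 2\<close> serve as two common directions.\<close>
        have "0 \<le> pi / 2" "pi / 2 \<le> pi" "0 \<le> (0::real)" "0 \<le> pi" "0 < pi / 2" "pi / 2 - 0 < pi" by simp_all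
        then show False using directions_disjoint[OF ** *(3), of "pt p" 0 "pi / 2"]
          edge_directions[OF **(1) U p(1,2)] edge_directions[OF **(2) W p(3,4)] by blast
      qed
      qed
  qed
qed

text \<open>If the point is not a vertex of the tile, it lies inside an edge, and the tile fills the
  whole half-plane of directions.\<close>

lemma angle_interval:
  assumes "U \<in> \<T>" "pt p \<in> convex hull U"
  obtains l r where "0 \<le> l" "l < r" "r \<le> pi" "{t \<in> {0..pi}. feasible (convex hull U) (pt p) (e t)} = {l..r}"
    "r - l = (if pt p \<in> U then vangle U (pt p) else pi)"
proof (cases "pt p \<in> U")
  case True
  obtain Q R where "U = {pt p, Q, R}" using triangle_vertices[OF card_tile[OF assms(1)] True] by metis
  moreover from this have "(Q - pt p) \<bullet> n \<ge> 0" "(R - pt p) \<bullet> n \<ge> 0" using tile_above[OF assms(1)] by blast+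
  ultimately obtain l r where "0 \<le> l" "l < r" "r \<le> pi" "r - l = vangle U (pt p)"
    "{t \<in> {0..pi}. feasible (convex hull U) (pt p) (e t)} = {l..r}"
    using vertex_sector[OF _ noncollinear_tile[OF assms(1)] card_tile[OF assms(1)]] by blast
  then show thesis using True that[of l r] by simp
next
  case False
  then obtain a b W where ab: "a > 0" "b > 0" "pt p + a *\<^sub>R u \<in> U" "pt p - b *\<^sub>R u \<in> U"
    using base_point[OF card_tile[OF assms(1)] noncollinear_tile[OF assms(1)] tile_above[OF assms(1)] assms(2)] by metis
  then have "pt (p + a) \<in> convex hull U" "pt (p - b) \<in> convex hull U" by (simp_all add: algebra_simps hull_inc)
  then have "{t \<in> {0..pi}. feasible (convex hull U) (pt p) (e t)} = {0..pi}"
    using edge_directions(2)[OF assms(1), of "p - b" "p + a" p] ab by auto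
  then show thesis using that[of 0 pi] False by simp
qed

text \<open>If a direction were feasible for no tile at the point, short steps along it would avoid
  every tile: those at the point by infeasibility, the others because they are closed. Finitely many
  tiles allow one common step, which contradicts the covering.\<close>

lemma direction_cover:
  assumes "pt p \<in> convex hull {A, B, C}"
  shows "(\<Union>U\<in>{U\<in>\<T>. pt p \<in> convex hull U}. {t \<in> {0..pi}. feasible (convex hull U) (pt p) (e t)})
    = {t \<in> {0..pi}. feasible (convex hull {A, B, C}) (pt p) (e t)}"
proof (intro subset_antisym subsetI)
  fix t assume "t \<in> (\<Union>U\<in>{U\<in>\<T>. pt p \<in> convex hull U}. {t \<in> {0..pi}. feasible (convex hull U) (pt p) (e t)})"
  then show "t \<in> {t \<in> {0..pi}. feasible (convex hull {A, B, C}) (pt p) (e t)}"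
    using hull_tile unfolding feasible_def by blast
  next
  fix t assume t: "t \<in> {t \<in> {0..pi}. feasible (convex hull {A, B, C}) (pt p) (e t)}"
  show "t \<in> (\<Union>U\<in>{U\<in>\<T>. pt p \<in> convex hull U}. {t \<in> {0..pi}. feasible (convex hull U) (pt p) (e t)})"
  proof (rule ccontr)
    assume no: "\<not> ?thesis"
    have "\<forall>U\<in>\<T>. \<forall>\<^sub>F \<delta> in at_right 0. pt p + \<delta> *\<^sub>R e t \<notin> convex hull U"
    proof
      fix U assume U: "U \<in> \<T>"
      show "\<forall>\<^sub>F \<delta> in at_right 0. pt p + \<delta> *\<^sub>R e t \<notin> convex hull U"
      proof (cases "pt p \<in> convex hull U")
        case True
        then have "\<not> feasible (convex hull U) (pt p) (e t)" using no t U by auto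
        then show ?thesis unfolding feasible_def
          by (auto intro!: eventually_mono[OF eventually_at_right_less])
      next
        case False
        have "((\<lambda>\<delta>. pt p + \<delta> *\<^sub>R e t) \<longlongrightarrow> pt p + 0 *\<^sub>R e t) (at_right 0)" by (intro tendsto_intros)
        moreover have "open (- (convex hull U))" using compact_imp_closed[OF compact_tile[OF U]] by auto
        ultimately have "\<forall>\<^sub>F \<delta> in at_right 0. pt p + \<delta> *\<^sub>R e t \<in> - (convex hull U)"
          using False by (intro topological_tendstoD) auto
        then show ?thesis by simp
      qed
    qed
    then have "\<forall>\<^sub>F \<delta> in at_right 0. \<forall>U\<in>\<T>. pt p + \<delta> *\<^sub>R e t \<notin> convex hull U"
      using finite_tiles by (simp add: eventually_ball_finite)
    moreover have "\<forall>\<^sub>F \<delta> in at_right 0. pt p + \<delta> *\<^sub>R e t \<in> convex hull {A, B, C}"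
      using t assms by (intro feasible_eventually) auto
    ultimately have "\<forall>\<^sub>F \<delta> in at_right (0::real). False"
      by eventually_elim (use cover in blast)
    then show False by simp
  qed
qed

end

text \<open>The length of an edge that is only available as an intersection of vertex sets, without
  an order of its ends.\<close>

definition pair_dist :: "point set \<Rightarrow> real" where
  "pair_dist X = (THE d. \<exists>P Q. X = {P, Q} \<and> d = dist P Q)"

lemma pair_dist_eq[simp]: "pair_dist {P, Q} = dist P Q"
  unfolding pair_dist_def by (rule the_equality) (auto simp: doubleton_eq_iff dist_commute)

lemma card_2_other:
  assumes "card X = 2" "x \<in> X"
  obtains y where "X = {x, y}" "x \<noteq> y"
proof -
  obtain p q where "X = {p, q}" "p \<noteq> q" using assms(1) unfolding card_2_iff by (elim exE conjE)
  then show thesis using assms(2) that[of p] that[of q] by (auto simp: insert_commute)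
qed

context triangle_tiling_chart begin

text \<open>The hypothesis that \<open>U0\<close> has a vertex at the point rules out tiles with the
  point inside an edge: such a tile would use up \<open>pi\<close> alone, while the total is at most
  \<open>pi\<close> and \<open>U0\<close> takes a positive part of it. So all tiles at the point
  contribute a vertex angle.\<close>

lemma angle_sum:
  assumes U0: "U0 \<in> \<T>" "pt p \<in> U0"
    and V: "{t \<in> {0..pi}. feasible (convex hull {A, B, C}) (pt p) (e t)} = {lo..hi}" "lo \<le> hi" "hi - lo \<le> pi"
  shows "(\<Sum>U\<in>{U\<in>\<T>. pt p \<in> U}. vangle U (pt p)) = hi - lo"
proof -
  define I where "I = {U\<in>\<T>. pt p \<in> convex hull U}"
  have finI: "finite I" using finite_tiles by (simp add: I_def)
  have "\<forall>U\<in>I. \<exists>l r. 0 \<le> l \<and> l < r \<and> r \<le> pi \<and> {t \<in> {0..pi}. feasible (convex hull U) (pt p) (e t)} = {l..r} \<and>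
      r - l = (if pt p \<in> U then vangle U (pt p) else pi)"
  proof
    fix U assume "U \<in> I"
    then have "U \<in> \<T>" "pt p \<in> convex hull U" by (simp_all add: I_def)
    then obtain l r where "0 \<le> l" "l < r" "r \<le> pi" "{t \<in> {0..pi}. feasible (convex hull U) (pt p) (e t)} = {l..r}"
      "r - l = (if pt p \<in> U then vangle U (pt p) else pi)" by (rule angle_interval)
    then show "\<exists>l r. 0 \<le> l \<and> l < r \<and> r \<le> pi \<and>
      {t \<in> {0..pi}. feasible (convex hull U) (pt p) (e t)} = {l..r} \<and>
      r - l = (if pt p \<in> U then vangle U (pt p) else pi)" by (intro exI conjI)
  qed
  from bchoice[OF this] obtain l where "\<forall>U\<in>I. \<exists>r. 0 \<le> l U \<and> l U < r \<and> r \<le> pi \<and>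
      {t \<in> {0..pi}. feasible (convex hull U) (pt p) (e t)} = {l U..r} \<and>
      r - l U = (if pt p \<in> U then vangle U (pt p) else pi)" ..
  from bchoice[OF this] obtain r where "\<forall>U\<in>I. 0 \<le> l U \<and> l U < r U \<and> r U \<le> pi \<and>
      {t \<in> {0..pi}. feasible (convex hull U) (pt p) (e t)} = {l U..r U} \<and>
      r U - l U = (if pt p \<in> U then vangle U (pt p) else pi)" ..
  note LR = bspec[OF this]
  have lr: "0 \<le> l U" "l U < r U" "r U \<le> pi" "r U - l U = (if pt p \<in> U then vangle U (pt p) else pi)"
    and directions: "{t \<in> {0..pi}. feasible (convex hull U) (pt p) (e t)} = {l U..r U}" if "U \<in> I" for U
    using LR[OF that] by (simp_all only: simp_thms)
  have feas: "feasible (convex hull U) (pt p) (e t)" if "U \<in> I" "l U \<le> t" "t \<le> r U" for U t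
  proof -
    have "t \<in> {l U..r U}" using that by simp
    then have "t \<in> {t \<in> {0..pi}. feasible (convex hull U) (pt p) (e t)}"
      unfolding directions[OF that(1)] .
    then show ?thesis by simp
  qed
  have pV: "pt p \<in> convex hull {A, B, C}" using tile_subset_hull U0 by blast
  have "(\<Union>U\<in>I. {l U..r U}) = (\<Union>U\<in>I. {t \<in> {0..pi}. feasible (convex hull U) (pt p) (e t)})"
    by (intro SUP_cong refl directions[symmetric])
  also have "\<dots> = {lo..hi}" unfolding I_def direction_cover[OF pV] V(1) ..
  finally have cov: "(\<Union>U\<in>I. {l U..r U}) = {lo..hi}" .
  have sum: "(\<Sum>U\<in>I. r U - l U) = hi - lo"
  proof (rule interval_tiling_sum[OF finI cov V(2)])
    show "l U \<le> r U" if "U \<in> I" for U using lr[OF that] by simp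
  next
    fix U W assume UW: "U \<in> I" "W \<in> I" "U \<noteq> W"
    show "{l U<..<r U} \<inter> {l W<..<r W} = {}"
    proof (rule ccontr)
      assume "\<not> ?thesis"
      then have "max (l U) (l W) < min (r U) (r W)" by auto
      then obtain t where t: "max (l U) (l W) < t" "t < min (r U) (r W)" using dense by blast
      show False
      proof (rule directions_disjoint[OF _ _ UW(3), of "pt p" "max (l U) (l W)" t])
        show "t - max (l U) (l W) < pi" using t lr[OF UW(1)] by auto
      qed (use UW t feas[OF UW(1)] feas[OF UW(2)] in \<open>auto simp: I_def\<close>)
    qed
  qed
  have "pt p \<in> U" if "U \<in> I" for U
  proof (rule ccontr)
    assume "pt p \<notin> U"
    then have "r U - l U = pi" "U \<noteq> U0" using lr(4)[OF that] U0 by auto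
    moreover have "U0 \<in> I" using U0 by (simp add: I_def hull_inc)
    moreover from this have "r U0 - l U0 > 0" using lr(2) by simp
    moreover have "(\<Sum>U\<in>{U, U0}. r U - l U) \<le> (\<Sum>U\<in>I. r U - l U)"
      using finI that \<open>U0 \<in> I\<close> lr(2) by (intro sum_mono2) (auto simp: less_imp_le)
    ultimately show False using sum V(3) by simp
  qed
  note vertex = this
  have "I = {U\<in>\<T>. pt p \<in> U}"
  proof (intro subset_antisym subsetI)
    fix U assume "U \<in> I"
    then show "U \<in> {U\<in>\<T>. pt p \<in> U}" using vertex[of U] by (simp add: I_def)
  qed (simp add: I_def hull_inc)
  moreover have "(\<Sum>U\<in>I. r U - l U) = (\<Sum>U\<in>I. vangle U (pt p))"
    using lr(4) vertex by (intro sum.cong) auto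
  ultimately show ?thesis using sum by simp
qed

lemma base_vertices: "A = pt 0" "B = pt (dist A B)"
  using base by simp_all

text \<open>A tile containing \<open>A\<close> with no vertex there would extend along the line
  \<open>A B\<close> beyond \<open>A\<close>, outside the tiled triangle.\<close>

lemma corner_tile: "\<exists>U\<in>\<T>. A \<in> U"
proof -
  have "A \<in> convex hull {A, B, C}" by (simp add: hull_inc)
  then obtain U where U: "U \<in> \<T>" "A \<in> convex hull U" using cover by blast
  have "A \<in> U"
  proof (rule ccontr)
    assume "A \<notin> U"
    then obtain a b where ab: "b > 0" "A - b *\<^sub>R u \<in> U"
      using base_point[OF card_tile[OF U(1)] noncollinear_tile[OF U(1)] _ U(2)] tile_above[OF U(1), of _ 0] by auto
    have "pt (- b) \<in> convex hull {A, B, C}" using tile_subset_hull[OF U(1) ab(2)] by simp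
    then show False using ab(1) unfolding pt_in_hull by simp
  qed
  then show ?thesis using U(1) by blast
qed

lemma corner_angle_sum: "(\<Sum>U\<in>{U\<in>\<T>. A \<in> U}. vangle U A) = angle B A C"
proof -
  obtain U0 where U0: "U0 \<in> \<T>" "A \<in> U0" using corner_tile by blast
  have card: "card {A, B, C} = 3"
    using noncollinear by (auto simp: card_insert_if insert_commute)
  obtain lo hi where "0 \<le> lo" "lo < hi" "hi \<le> pi" "hi - lo = vangle {A, B, C} A"
    "{t \<in> {0..pi}. feasible (convex hull {A, B, C}) A (e t)} = {lo..hi}"
    using vertex_sector[OF refl noncollinear card] apex hull_coordinates(1)[of B] by (auto simp: hull_inc)
  then show ?thesis using angle_sum[of U0 0 lo hi] U0 vangle_eq[OF refl card] by simp
qed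

lemma straight_angle_sum:
  assumes "P \<in> open_segment A B" "U0 \<in> \<T>" "P \<in> U0"
  shows "(\<Sum>U\<in>{U\<in>\<T>. P \<in> U}. vangle U P) = pi"
proof -
  obtain p where p: "0 \<le> p" "p \<le> dist A B" "P = pt p" using assms(1) segment_pt by (auto simp: open_segment_def)
  have "P \<noteq> A" "P \<noteq> B" using assms(1) by (auto simp: open_segment_def)
  then have "p \<noteq> 0" "p \<noteq> dist A B" using p(3) base_vertices by auto
  then have p': "0 < p" "p < dist A B" using p by simp_all
  have "feasible (convex hull {A, B, C}) (pt p) (e t)" if "t \<in> {0..pi}" for t
    using that p' apex
    by (intro edge_sector[OF convex_convex_hull, of _ _ "dist A B - p" p C])
       (auto simp: hull_inc pt_in_hull algebra_simps base_vertices(2)[symmetric] inner_diff_left)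
  then have "{t \<in> {0..pi}. feasible (convex hull {A, B, C}) (pt p) (e t)} = {0..pi}" by auto
  then show ?thesis using angle_sum[of U0 p 0 pi] assms p(3) by simp
qed

text \<open>The three facts share one family of intervals. The tiles with two vertices on the side
  are exactly those whose interval has positive length. In the last fact, \<open>m\<close> marks a
  vertex of each tile along the side; it will be the vertex of the largest angle.\<close>

lemma side_facts:
  shows "(\<Sum>U\<in>{U\<in>\<T>. card (U \<inter> closed_segment A B) = 2}. pair_dist (U \<inter> closed_segment A B)) = dist A B" (is ?sum)
    and "\<exists>U\<in>\<T>. card (U \<inter> closed_segment A B) = 2 \<and> A \<in> U" (is ?start)
    and "(\<And>U. U \<in> \<T> \<Longrightarrow> card (U \<inter> closed_segment A B) = 2 \<Longrightarrow> m U \<in> U \<inter> closed_segment A B - {A, B}) \<Longrightarrow>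
      \<exists>U\<in>\<T>. \<exists>W\<in>\<T>. U \<noteq> W \<and> card (U \<inter> closed_segment A B) = 2 \<and> card (W \<inter> closed_segment A B) = 2 \<and> m U = m W"
      (is "PROP ?marked \<Longrightarrow> ?pigeonhole")
proof -
  have finI: "finite touching" using finite_tiles by (simp add: touching_def)
  obtain l r where LR: "\<forall>U\<in>touching. l U \<le> r U \<and> U \<inter> closed_segment A B = {pt (l U), pt (r U)} \<and> 0 \<le> l U \<and> r U \<le> dist A B"
    and cov: "(\<Union>U\<in>touching. {l U..r U}) = {0..dist A B}"
    and disj: "\<forall>U\<in>touching. \<forall>W\<in>touching. U \<noteq> W \<longrightarrow> {l U<..<r U} \<inter> {l W<..<r W} = {}"
    by (rule side_intervals)
  have lr: "l U \<le> r U" "U \<inter> closed_segment A B = {pt (l U), pt (r U)}" "0 \<le> l U" "r U \<le> dist A B"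
    if "U \<in> touching" for U
    using bspec[OF LR that] by (simp_all only: simp_thms)
  have dis: "{l U<..<r U} \<inter> {l W<..<r W} = {}" if "U \<in> touching" "W \<in> touching" "U \<noteq> W" for U W
    using disj that by (simp only: simp_thms)
  have card: "card (U \<inter> closed_segment A B) = 2 \<longleftrightarrow> l U < r U" if "U \<in> touching" for U
    using lr[OF that] by (auto simp: card_insert_if)
  have E: "{U\<in>\<T>. card (U \<inter> closed_segment A B) = 2} = {U\<in>touching. l U < r U}"
  proof (intro subset_antisym subsetI)
    fix U assume U: "U \<in> {U\<in>\<T>. card (U \<inter> closed_segment A B) = 2}"
    then have "U \<inter> closed_segment A B \<noteq> {}" by auto
    then have "U \<in> touching" using U hull_subset[of U convex] by (auto simp: touching_def)
    then show "U \<in> {U\<in>touching. l U < r U}" using U card by simp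
  qed (use card in \<open>auto simp: touching_def\<close>)
  have "(\<Sum>U\<in>{U\<in>touching. l U < r U}. pair_dist (U \<inter> closed_segment A B)) = (\<Sum>U\<in>{U\<in>touching. l U < r U}. r U - l U)"
    using lr by (intro sum.cong) (auto simp: dist_norm norm_eq_sqrt_inner[of u] simp flip: scaleR_diff_left)
  also have "\<dots> = (\<Sum>U\<in>touching. r U - l U)"
    using finI lr by (intro sum.mono_neutral_left) force+
  also have "\<dots> = dist A B" using interval_tiling_sum[OF finI cov _ _ dis] lr by simp
  finally show ?sum unfolding E .
  obtain U where U: "U \<in> touching" "l U \<le> 0" "0 < r U" using interval_cover_right[OF finI cov, of 0] L_pos by auto
  then have "l U = 0" using lr by force
  have "card (U \<inter> closed_segment A B) = 2" using U card[OF U(1)] \<open>l U = 0\<close> by simp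
  moreover have "U \<in> \<T>" using U by (simp add: touching_def)
  moreover have "A \<in> U" using lr(2)[OF U(1)] \<open>l U = 0\<close> by auto
  ultimately show ?start by blast
  show ?pigeonhole if m: "PROP ?marked"
  proof -
    define m' where "m' = (\<lambda>U. (m U - A) \<bullet> u)"
    have m': "m U = pt (m' U)" "m' U \<in> {l U, r U} - {0, dist A B}" if "U \<in> touching" "l U < r U" for U
    proof -
      have "m U \<in> {pt (l U), pt (r U)} - {pt 0, pt (dist A B)}"
        using m[of U] that E lr[OF that(1)] base_vertices by auto
      then show "m U = pt (m' U)" "m' U \<in> {l U, r U} - {0, dist A B}" unfolding m'_def by auto
    qed
    from interval_tiling_pigeonhole[OF finI cov L_pos dis m'(2)] obtain U W where
      "U \<in> touching" "W \<in> touching" "l U < r U" "l W < r W" "U \<noteq> W" "m' U = m' W" by blast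
    moreover from this have "m U = m W" using m'(1)[of U] m'(1)[of W] by simp
    moreover have "U \<in> \<T>" "W \<in> \<T>" using calculation by (simp_all add: touching_def)
    ultimately show ?thesis using card by blast
  qed
qed

end

section \<open>Corners and sides without coordinates\<close>

context triangle_tiling begin

lemma chart_ex:
  obtains u n where "triangle_tiling_chart A B C \<T> u n"
proof -
  obtain u n where *: "chart u n" "B = A + dist A B *\<^sub>R u" "(C - A) \<bullet> n > 0"
    using chart_exists[OF noncollinear] by metis
  then have "triangle_tiling_chart A B C \<T> u n"
    by (intro triangle_tiling_chart.intro triangle_tiling_axioms) (auto simp: triangle_tiling_chart_axioms_def)
  then show thesis by (rule that)
qed

lemma corner_angles: "(\<Sum>U\<in>{U\<in>\<T>. A \<in> U}. vangle U A) = angle B A C"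
proof -
  obtain u n where "triangle_tiling_chart A B C \<T> u n" by (rule chart_ex)
  then show ?thesis by (rule triangle_tiling_chart.corner_angle_sum)
qed

lemma straight_angles:
  assumes "P \<in> open_segment A B" "U \<in> \<T>" "P \<in> U"
  shows "(\<Sum>U\<in>{U\<in>\<T>. P \<in> U}. vangle U P) = pi"
proof -
  obtain u n where "triangle_tiling_chart A B C \<T> u n" by (rule chart_ex)
  then show ?thesis using assms by (rule triangle_tiling_chart.straight_angle_sum)
qed

lemma side_sum: "(\<Sum>U\<in>{U\<in>\<T>. card (U \<inter> closed_segment A B) = 2}. pair_dist (U \<inter> closed_segment A B)) = dist A B"
proof -
  obtain u n where "triangle_tiling_chart A B C \<T> u n" by (rule chart_ex)
  then show ?thesis by (rule triangle_tiling_chart.side_facts(1))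
qed

lemma side_start: "\<exists>U\<in>\<T>. card (U \<inter> closed_segment A B) = 2 \<and> A \<in> U"
proof -
  obtain u n where "triangle_tiling_chart A B C \<T> u n" by (rule chart_ex)
  then show ?thesis by (rule triangle_tiling_chart.side_facts(2))
qed

lemma side_pigeonhole:
  assumes "\<And>U. U \<in> \<T> \<Longrightarrow> card (U \<inter> closed_segment A B) = 2 \<Longrightarrow> m U \<in> U \<inter> closed_segment A B - {A, B}"
  obtains U W where "U \<in> \<T>" "W \<in> \<T>" "U \<noteq> W" "card (U \<inter> closed_segment A B) = 2"
    "card (W \<inter> closed_segment A B) = 2" "m U = m W"
proof -
  obtain u n where "triangle_tiling_chart A B C \<T> u n" by (rule chart_ex)
  from triangle_tiling_chart.side_facts(3)[OF this assms] show thesis using that by blast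
qed

lemma swap: "triangle_tiling B A C \<T>" "triangle_tiling A C B \<T>"
  using triangle_tiling_axioms unfolding triangle_tiling_def by (simp_all add: insert_commute)

text \<open>Both sides at \<open>A\<close> start with an edge of a tile that has \<open>A\<close> as
  a vertex. As there is only one such tile, it has an edge on each of the two sides.\<close>

lemma unsplit_corner:
  assumes "{U\<in>\<T>. A \<in> U} = {U}"
  obtains Q R where "U = {A, Q, R}" "U \<inter> closed_segment A B = {A, Q}" "U \<inter> closed_segment A C = {A, R}"
    "A \<noteq> Q" "A \<noteq> R" "Q \<noteq> R"
proof -
  have "U \<in> {U\<in>\<T>. A \<in> U}" unfolding assms by simp
  then have U: "U \<in> \<T>" "A \<in> U" by simp_all
  have unique: "W = U" if "W \<in> \<T>" "A \<in> W" for W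
  proof -
    have "W \<in> {U\<in>\<T>. A \<in> U}" using that by simp
    then show ?thesis unfolding assms by simp
  qed
  obtain W where "W \<in> \<T>" "card (W \<inter> closed_segment A B) = 2" "A \<in> W"
    using side_start by (elim bexE conjE)
  with unique U have 1: "card (U \<inter> closed_segment A B) = 2" "A \<in> U" "U \<in> \<T>" by simp_all
  obtain W' where "W' \<in> \<T>" "card (W' \<inter> closed_segment A C) = 2" "A \<in> W'"
    using triangle_tiling.side_start[OF swap(2)] by (elim bexE conjE)
  with unique have 2: "card (U \<inter> closed_segment A C) = 2" by simp
  obtain Q where Q: "U \<inter> closed_segment A B = {A, Q}" "A \<noteq> Q"
    using card_2_other[OF 1(1), of A] 1(2) by auto
  obtain R where R: "U \<inter> closed_segment A C = {A, R}" "A \<noteq> R"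
    using card_2_other[OF 2, of A] 1(2) by auto
  have "Q \<noteq> R"
  proof
    assume "Q = R"
    then have "Q \<in> closed_segment A B" "Q \<in> closed_segment A C" using Q R by blast+
    then obtain s t where s: "Q = (1 - s) *\<^sub>R A + s *\<^sub>R B" and t: "Q = (1 - t) *\<^sub>R A + t *\<^sub>R C"
      unfolding closed_segment_def by blast
    have st: "Q - A = s *\<^sub>R (B - A)" "Q - A = t *\<^sub>R (C - A)"
      by (subst s, simp add: algebra_simps) (subst t, simp add: algebra_simps)
    then have "t \<noteq> 0" using Q(2) by auto
    then have "C - A = (1 / t) *\<^sub>R (Q - A)" unfolding st(2) by simp
    then have "C - A = (s / t) *\<^sub>R (B - A)" unfolding st(1) by simp
    then have "collinear {0, B - A, C - A}" unfolding collinear_lemma by blast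
    then show False using noncollinear collinear_shift by blast
  qed
  then have "card {A, Q, R} = 3" using Q R by simp
  moreover have "{A, Q, R} \<subseteq> U" using Q R by blast
  ultimately have "U = {A, Q, R}"
    using card_tile[OF 1(3)] by (metis card.infinite card_subset_eq zero_neq_numeral)
  then show thesis using that Q R \<open>Q \<noteq> R\<close> by blast
qed

end

section \<open>Signs of sides\<close>

lemma additive_map_sum_list:
  fixes \<phi> :: "real \<Rightarrow> real"
  assumes "\<And>x y. \<phi> (x + y) = \<phi> x + \<phi> y"
  shows "\<phi> (sum_list L) = sum_list (map \<phi> L)"
proof -
  have "\<phi> 0 = 0" using assms[of 0 0] by simp
  then show ?thesis by (induction L) (simp_all add: assms)
qed

lemma sum_list_const: "(\<And>y. y \<in> set L \<Longrightarrow> y = v) \<Longrightarrow> sum_list L = real (length L) * (v::real)"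
  by (induction L) (auto simp: algebra_simps)

text \<open>With \<open>\<rho>\<close> the maximum of \<open>\<bar>\<phi> x\<bar> / x\<close> over \<open>S\<close>, the sign of \<open>x\<close> is \<open>\<plusminus>1\<close> if \<open>\<phi> x = \<plusminus>\<rho> x\<close>, and \<open>0\<close> otherwise.
  Since \<open>\<phi> (s x) = - s \<phi> x\<close>, equality must hold in every
  summand of a decomposition of \<open>s x\<close>, with the opposite sign.\<close>

lemma sign_function:
  fixes s :: real and S :: "real set"
  assumes s: "s > 0" "s \<notin> \<rat>" "s\<^sup>2 \<in> \<rat>"
    and S: "finite S" "S \<noteq> {}" "\<And>x. x \<in> S \<Longrightarrow> x > 0"
    and dec: "\<And>x. x \<in> S \<Longrightarrow> \<exists>L. set L \<subseteq> S \<and> sum_list L = s * x"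
  obtains \<sigma> :: "real \<Rightarrow> int" where
    "\<And>x. \<sigma> x \<in> {-1, 0, 1}" "1 \<in> \<sigma> ` S" "-1 \<in> \<sigma> ` S"
    "\<And>x y L. x \<in> S \<Longrightarrow> set L \<subseteq> S \<Longrightarrow> sum_list L = s * x \<Longrightarrow> \<sigma> x \<noteq> 0 \<Longrightarrow> y \<in> set L \<Longrightarrow> \<sigma> y = - \<sigma> x"
proof -
  obtain a where a: "a \<in> S" using S by auto
  then have "a \<noteq> 0" using S(3) by force
  then obtain \<phi> where add: "\<And>x y. \<phi> (x + y) = \<phi> x + \<phi> y" and conj: "\<And>x. \<phi> (s * x) = - s * \<phi> x" and "\<phi> a \<noteq> 0"
    using additive_conjugation[OF s(2,3)] by metis
  define \<rho> where "\<rho> = Max ((\<lambda>x. \<bar>\<phi> x\<bar> / x) ` S)"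
  have "\<bar>\<phi> x\<bar> / x \<le> \<rho>" if "x \<in> S" for x unfolding \<rho>_def using S that by (intro Max_ge) auto
  then have le: "\<bar>\<phi> x\<bar> \<le> \<rho> * x" if "x \<in> S" for x
    using S(3)[OF that] \<open>\<And>x. x \<in> S \<Longrightarrow> \<bar>\<phi> x\<bar> / x \<le> \<rho>\<close>[OF that] by (simp add: pos_divide_le_eq)
  have "0 < \<bar>\<phi> a\<bar> / a" using \<open>\<phi> a \<noteq> 0\<close> S(3)[OF a] by simp
  then have "\<rho> > 0" using \<open>\<And>x. x \<in> S \<Longrightarrow> \<bar>\<phi> x\<bar> / x \<le> \<rho>\<close>[OF a] by linarith
  \<comment> \<open>The value 0 on nonpositive arguments makes a nonzero sign imply
    \<open>x > 0\<close>, and keeps the cases \<open>\<rho> * x\<close> and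
    \<open>- (\<rho> * x)\<close> distinct.\<close>
  define \<sigma> :: "real \<Rightarrow> int" where "\<sigma> = (\<lambda>x. if x \<le> 0 then 0 else if \<phi> x = \<rho> * x then 1 else if \<phi> x = - (\<rho> * x) then -1 else 0)"
  have \<sigma>_eq: "\<phi> x = of_int (\<sigma> x) * \<rho> * x" "x > 0" if "\<sigma> x \<noteq> 0" for x
    using that by (auto simp: \<sigma>_def split: if_splits)
  have \<sigma>_cases: "\<sigma> x \<in> {-1, 0, 1}" for x by (simp add: \<sigma>_def)
  have opp: "\<sigma> y = - \<sigma> x"
    if x: "x \<in> S" and L: "set L \<subseteq> S" "sum_list L = s * x" and nz: "\<sigma> x \<noteq> 0" and y: "y \<in> set L" for x y L
  proof -
    define \<epsilon> where "\<epsilon> = real_of_int (\<sigma> x)"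
    have \<epsilon>: "\<epsilon> = 1 \<or> \<epsilon> = -1" using \<sigma>_cases[of x] nz by (auto simp: \<epsilon>_def)
    \<comment> \<open>Each summand is nonnegative by the choice of \<open>\<rho>\<close>, and the
      total turns out to be zero, so every summand vanishes.\<close>
    have "sum_list (map (\<lambda>z. \<rho> * z + \<epsilon> * \<phi> z) L) = \<rho> * sum_list L + \<epsilon> * \<phi> (sum_list L)"
      unfolding additive_map_sum_list[of \<phi>, OF add] by (induction L) (simp_all add: algebra_simps)
    also have "\<dots> = \<rho> * (s * x) - s * (\<epsilon> * \<phi> x)" unfolding L conj by simp
    also have "\<epsilon> * \<phi> x = \<rho> * x" using \<sigma>_eq(1)[OF nz] \<epsilon> by (auto simp flip: \<epsilon>_def)
    finally have "sum_list (map (\<lambda>z. \<rho> * z + \<epsilon> * \<phi> z) L) = 0" by simp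
    moreover have nn: "\<rho> * z + \<epsilon> * \<phi> z \<ge> 0" if "z \<in> set L" for z
      using le[of z] L(1) that \<epsilon> by (auto simp: abs_le_iff)
    ultimately have "\<forall>z\<in>set (map (\<lambda>z. \<rho> * z + \<epsilon> * \<phi> z) L). z = 0"
      by (subst (asm) sum_list_nonneg_eq_0_iff) auto
    then have "\<rho> * y + \<epsilon> * \<phi> y = 0" using y by simp
    moreover have "y > 0" using S(3) L(1) y by auto
    moreover from this \<open>\<rho> > 0\<close> have "\<rho> * y > 0" by simp
    moreover have "\<sigma> x = 1 \<or> \<sigma> x = -1" using \<sigma>_cases[of x] nz by auto
    ultimately show ?thesis
    proof (elim disjE)
      assume "\<sigma> x = 1" "\<rho> * y + \<epsilon> * \<phi> y = 0" "y > 0" "\<rho> * y > 0"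
      then have "\<phi> y = - (\<rho> * y)" "\<phi> y \<noteq> \<rho> * y" by (simp_all add: \<epsilon>_def)
      then show ?thesis using \<open>\<sigma> x = 1\<close> \<open>y > 0\<close> by (simp add: \<sigma>_def[THEN fun_cong, of y])
    next
      assume "\<sigma> x = -1" "\<rho> * y + \<epsilon> * \<phi> y = 0" "y > 0"
      then have "\<phi> y = \<rho> * y" by (simp add: \<epsilon>_def)
      then show ?thesis using \<open>\<sigma> x = -1\<close> \<open>y > 0\<close> by (simp add: \<sigma>_def[THEN fun_cong, of y])
    qed
  qed
  \<comment> \<open>A length attaining the maximum has a nonzero sign, and any edge in a
    decomposition of its multiple has the other sign. Hence both occur.\<close>
  have "\<rho> \<in> (\<lambda>x. \<bar>\<phi> x\<bar> / x) ` S" unfolding \<rho>_def using S by (intro Max_in) auto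
  then obtain b where b: "b \<in> S" "\<rho> = \<bar>\<phi> b\<bar> / b" by auto
  then have "b > 0" "\<bar>\<phi> b\<bar> = \<rho> * b" using S(3)[of b] by auto
  then have nz: "\<sigma> b \<noteq> 0" by (auto simp: \<sigma>_def abs_if split: if_splits)
  obtain L where L: "set L \<subseteq> S" "sum_list L = s * b" using dec[OF b(1)] by blast
  then have "L \<noteq> []" using s \<open>b > 0\<close> by auto
  then obtain y where y: "y \<in> set L" by (cases L) auto
  then have "\<sigma> y = - \<sigma> b" using opp[OF b(1) L nz] by simp
  then have "1 \<in> \<sigma> ` S \<and> -1 \<in> \<sigma> ` S"
  proof -
    have "\<sigma> b \<in> \<sigma> ` S" "- \<sigma> b \<in> \<sigma> ` S"
      using b(1) y L(1) unfolding \<open>\<sigma> y = - \<sigma> b\<close>[symmetric] by auto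
    moreover have "\<sigma> b = 1 \<or> \<sigma> b = -1" using \<sigma>_cases[of b] nz by auto
    ultimately show ?thesis by (elim disjE) simp_all
  qed
  then show thesis using that[of \<sigma>] \<sigma>_cases opp by blast
qed

text \<open>\<open>X\<close> and \<open>Y\<close> stand for the edge lengths occurring on the sides
  \<open>s x\<close> and \<open>s y\<close>. If \<open>x\<close> or \<open>y\<close> has a nonzero
  sign, its own side carries no edge of that length and no neutral edge, which forces
  \<open>y\<close> onto \<open>s x\<close> and \<open>x\<close> onto \<open>s y\<close>. If both
  were neutral, \<open>z\<close> would need both signs.\<close>

lemma unsplit_corner_signs:
  fixes \<sigma> :: "real \<Rightarrow> int"
  assumes "\<And>x. \<sigma> x \<in> {-1, 0, 1}" "1 \<in> \<sigma> ` {x, y, z}" "-1 \<in> \<sigma> ` {x, y, z}"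
    and X: "\<And>w. \<sigma> x \<noteq> 0 \<Longrightarrow> w \<in> X \<Longrightarrow> \<sigma> w = - \<sigma> x" and Y: "\<And>w. \<sigma> y \<noteq> 0 \<Longrightarrow> w \<in> Y \<Longrightarrow> \<sigma> w = - \<sigma> y"
    and "x \<in> X \<and> y \<in> Y \<or> y \<in> X \<and> x \<in> Y"
  shows "\<sigma> x \<noteq> 0" "\<sigma> y = - \<sigma> x"
proof -
  have "\<sigma> x \<noteq> 0 \<and> \<sigma> y = - \<sigma> x"
  proof (cases "\<sigma> x = 0 \<and> \<sigma> y = 0")
    case True
    then show ?thesis using assms(2,3) by auto
  next
    case False
    have "\<sigma> x \<noteq> 0"
    proof
      assume "\<sigma> x = 0"
      then have "y \<notin> Y" "x \<notin> Y" using False Y[of y] Y[of x] by auto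
      then show False using assms(6) by blast
    qed
    moreover from this have "x \<notin> X" using X[of x] by auto
    ultimately show ?thesis using assms(6) X[of y] by blast
  qed
  then show "\<sigma> x \<noteq> 0" "\<sigma> y = - \<sigma> x" by auto
qed

text \<open>Doubling the angle replaces the square of the cosine by a cosine, since
  \<open>cos (2 * \<alpha>) = 2 * (cos \<alpha>)\<^sup>2 - 1\<close>.\<close>

lemma multiple_angle_eq_pi_div_6:
  fixes \<alpha> :: real and k :: nat
  assumes "k \<ge> 2" "\<alpha> + real k * \<alpha> = pi / 2" "(cos \<alpha>)\<^sup>2 \<in> \<rat>"
  shows "\<alpha> = pi / 6"
proof -
  have "real (Suc k) * \<alpha> = pi / 2" using assms(2) by (simp add: algebra_simps)
  then have \<alpha>: "2 * \<alpha> = pi / real (Suc k)" by (simp add: field_simps)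
  have "cos (2 * \<alpha>) \<in> \<rat>" unfolding cos_double_cos using assms(3) by auto
  then have "Suc k = 3" unfolding \<alpha> using assms(1) by (intro cos_pi_div_rational) auto
  then show ?thesis using \<alpha> by simp
qed

text \<open>The arithmetic that remains once the right angle is known. The lists hold the edges
  along the three sides; \<open>splitB\<close> and \<open>splitC\<close> express that each of the
  two corners either is split or separates the signs of its adjacent sides.\<close>

lemma right_triangle_sides:
  fixes a b c s \<alpha> \<beta> :: real and \<sigma> :: "real \<Rightarrow> int" and N :: nat
  assumes pos: "a > 0" "b > 0" "c > 0" "s > 0" and s: "s\<^sup>2 = real N"
    and \<sigma>: "\<sigma> b \<noteq> 0" "\<sigma> c = - \<sigma> b"
    and La: "set La \<subseteq> {a, b, c}" "sum_list La = s * a" "\<And>y. \<sigma> a \<noteq> 0 \<Longrightarrow> y \<in> set La \<Longrightarrow> \<sigma> y = - \<sigma> a"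
    and Lb: "set Lb \<subseteq> {a, b, c}" "sum_list Lb = s * b" "\<And>y. y \<in> set Lb \<Longrightarrow> \<sigma> y = - \<sigma> b"
    and Lc: "set Lc \<subseteq> {a, b, c}" "sum_list Lc = s * c" "\<And>y. y \<in> set Lc \<Longrightarrow> \<sigma> y = - \<sigma> c"
    and \<sigma>a: "\<sigma> a \<in> {-1, 0, 1}" "\<sigma> b \<in> {-1, 0, 1}"
    and trig: "a = c * sin \<alpha>" "b = c * cos \<alpha>" "\<alpha> + \<beta> = pi / 2"
    and splitB: "(\<exists>k\<ge>2. \<beta> = real k * \<alpha>) \<or> \<sigma> a = - \<sigma> c"
    and splitC: "splitC \<or> \<sigma> a = - \<sigma> b"
  shows "\<alpha> = pi / 6 \<and> (\<exists>m::nat. N = 3 * m\<^sup>2) \<or>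
    splitC \<and> (\<exists>x y::nat. N = x\<^sup>2 + y\<^sup>2 \<and> a / b = real x / real y)"
proof -
  have sum: "a\<^sup>2 + b\<^sup>2 = c\<^sup>2" unfolding trig by (simp add: power_mult_distrib flip: distrib_left)
  consider "\<sigma> a = \<sigma> b" | "\<sigma> a = \<sigma> c" | "\<sigma> a = 0" using \<sigma> \<sigma>a by auto
  then show ?thesis
  proof cases
    case 1
    have "y = c" if "y \<in> set La" for y using that La(1) La(3)[of y] 1 \<sigma> by auto
    then have sa: "s * a = real (length La) * c" using sum_list_const La(2) by metis
    have "y = c" if "y \<in> set Lb" for y using that Lb(1) Lb(3)[of y] 1 \<sigma> by auto
    then have sb: "s * b = real (length Lb) * c" using sum_list_const Lb(2) by metis
    have "real N * c\<^sup>2 = (s * a)\<^sup>2 + (s * b)\<^sup>2"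
      unfolding s[symmetric] sum[symmetric] by (simp add: algebra_simps power_mult_distrib)
    also have "\<dots> = real ((length La)\<^sup>2 + (length Lb)\<^sup>2) * c\<^sup>2"
      unfolding sa sb by (simp add: algebra_simps power_mult_distrib)
    finally have "N = (length La)\<^sup>2 + (length Lb)\<^sup>2" using pos by (metis of_nat_eq_iff mult_cancel_right zero_less_power less_irrefl)
    moreover have "a / b = (s * a) / (s * b)" using pos by simp
    then have "a / b = real (length La) / real (length Lb)" unfolding sa sb using pos by simp
    moreover have splitC using splitC 1 \<sigma> by auto
    ultimately show ?thesis by blast
  next
    case 2
    \<comment> \<open>Here \<open>b\<close> is the only length of its sign, so both
      \<open>s a\<close> and \<open>s c\<close> are multiples of \<open>b\<close>, and
      \<open>sin \<alpha>\<close> is rational.\<close>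
    have "y = b" if "y \<in> set La" for y using that La(1) La(3)[of y] 2 \<sigma> by auto
    then have sa: "s * a = real (length La) * b" using sum_list_const La(2) by metis
    have "y = b" if "y \<in> set Lc" for y using that Lc(1) Lc(3)[of y] 2 \<sigma> by auto
    then have sc: "s * c = real (length Lc) * b" using sum_list_const Lc(2) by metis
    obtain k :: nat where k: "k \<ge> 2" "\<beta> = real k * \<alpha>" using splitB 2 \<sigma> by auto
    have "sin \<alpha> = (s * a) / (s * c)" using pos trig by simp
    then have "sin \<alpha> = real (length La) / real (length Lc)" unfolding sa sc using pos by simp
    then have "sin \<alpha> \<in> \<rat>" by simp
    then have "(cos \<alpha>)\<^sup>2 \<in> \<rat>" unfolding cos_squared_eq by auto
    then have \<alpha>: "\<alpha> = pi / 6" using multiple_angle_eq_pi_div_6 k trig(3) by simp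
    have "s * (c / 2) = real (length La) * (c * (sqrt 3 / 2))"
      using sa unfolding trig(1,2) \<alpha> sin_30 cos_30 by simp
    then have "s = real (length La) * sqrt 3" using pos by simp
    then have "real N = real (3 * (length La)\<^sup>2)" using s by (simp add: power_mult_distrib)
    then show ?thesis using \<alpha> by (metis of_nat_eq_iff)
  next
    case 3
    \<comment> \<open>With \<open>a\<close> neutral, \<open>c\<close> is the only length of sign
      opposite to \<open>b\<close>. So \<open>s b\<close> is a multiple of \<open>c\<close>, which
      makes the square of \<open>cos \<alpha>\<close> rational, though perhaps not
      \<open>cos \<alpha>\<close>.\<close>
    have "y = c" if "y \<in> set Lb" for y using that Lb(1) Lb(3)[of y] 3 \<sigma> by auto
    then have sb: "s * b = real (length Lb) * c" using sum_list_const Lb(2) by metis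
    obtain k :: nat where k: "k \<ge> 2" "\<beta> = real k * \<alpha>" using splitB 3 \<sigma> by auto
    have sc: "s * cos \<alpha> = real (length Lb)" using sb pos unfolding trig by simp
    then have "real N * (cos \<alpha>)\<^sup>2 = (real (length Lb))\<^sup>2" unfolding s[symmetric] by (metis power_mult_distrib)
    moreover have "real N \<noteq> 0" using pos(4) unfolding s[symmetric] by simp
    ultimately have N: "(cos \<alpha>)\<^sup>2 = (real (length Lb))\<^sup>2 / real N" by (simp add: nonzero_eq_divide_eq mult.commute)
    then have "(cos \<alpha>)\<^sup>2 \<in> \<rat>" by auto
    then have \<alpha>: "\<alpha> = pi / 6" using multiple_angle_eq_pi_div_6 k trig(3) by simp
    have "(cos \<alpha>)\<^sup>2 = 3 / 4" unfolding \<alpha> cos_30 by (simp add: power_divide)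
    then have "real N * (3 / 4) = (real (length Lb))\<^sup>2"
      using \<open>real N * (cos \<alpha>)\<^sup>2 = (real (length Lb))\<^sup>2\<close> by (simp only:)
    then have "real N * 3 = 4 * (real (length Lb))\<^sup>2" by simp
    then have "real (N * 3) = real (4 * (length Lb)\<^sup>2)" by simp
    then have N3: "N * 3 = 4 * (length Lb)\<^sup>2" by (simp only: of_nat_eq_iff)
    \<comment> \<open>Three times \<open>N\<close> is four times a square; extracting the factor 3
      from the root brings \<open>N\<close> into the form three times a square.\<close>
    then have "3 dvd 4 * (length Lb)\<^sup>2" by (metis dvd_triv_right)
    then have "3 dvd (length Lb)\<^sup>2" by presburger
    then have "(length Lb mod 3)\<^sup>2 mod 3 = 0" by (simp add: power_mod)
    moreover have "length Lb mod 3 = 0 \<or> length Lb mod 3 = 1 \<or> length Lb mod 3 = 2" by presburger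
    ultimately have "length Lb mod 3 = 0" by auto
    then have "3 dvd length Lb" by presburger
    then obtain m where "length Lb = 3 * m" by auto
    then have "N = 3 * (2 * m)\<^sup>2" using N3 by (simp add: power_mult_distrib)
    then show ?thesis using \<alpha> by blast
  qed
qed

section \<open>Similarity, area and angles of triangles\<close>

text \<open>Only distances are known to scale, so the inner product is first expressed by norms
  through polarisation.\<close>

lemma angle_similarity:
  assumes "\<And>x y. dist (f x) (f y) = k * dist x y" "k > 0"
  shows "angle (f X) (f Y) (f Z) = angle X Y Z"
proof -
  have n: "norm (f x - f y) = k * norm (x - y)" for x y using assms(1) by (simp add: dist_norm)
  have "(f X - f Y) \<bullet> (f Z - f Y) = ((norm (f X - f Y))\<^sup>2 + (norm (f Z - f Y))\<^sup>2 - (norm (f X - f Z))\<^sup>2) / 2"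
    using dot_norm_neg[of "f X - f Y" "f Z - f Y"] by simp
  also have "\<dots> = k\<^sup>2 * (((norm (X - Y))\<^sup>2 + (norm (Z - Y))\<^sup>2 - (norm (X - Z))\<^sup>2) / 2)"
    unfolding n power_mult_distrib by (simp add: algebra_simps)
  also have "((norm (X - Y))\<^sup>2 + (norm (Z - Y))\<^sup>2 - (norm (X - Z))\<^sup>2) / 2 = (X - Y) \<bullet> (Z - Y)"
    using dot_norm_neg[of "X - Y" "Z - Y"] by simp
  finally have "(f X - f Y) \<bullet> (f Z - f Y) = k\<^sup>2 * ((X - Y) \<bullet> (Z - Y))" .
  then show ?thesis using assms(2) unfolding angle_def n by (simp add: power2_eq_square)
qed

text \<open>Rescaling by \<open>1 / k\<close> and moving the image of 0 back to 0 leaves an isometry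
  fixing 0, which is an orthogonal map.\<close>

lemma similarity_form:
  fixes f :: "point \<Rightarrow> point"
  assumes "\<And>x y. dist (f x) (f y) = k * dist x y" "k > 0"
  obtains h where "orthogonal_transformation h" "f = (\<lambda>x. f 0 + k *\<^sub>R h x)"
proof -
  define h where "h = (\<lambda>x. (1 / k) *\<^sub>R (f x - f 0))"
  have "dist (h x) (h y) = dist x y" for x y
  proof -
    have "h x - h y = (1 / k) *\<^sub>R (f x - f y)" by (simp add: h_def algebra_simps)
    then have "norm (h x - h y) = norm (f x - f y) / k" using assms(2) by simp
    also have "\<dots> = norm (x - y)" using assms by (simp add: dist_norm)
    finally show ?thesis by (simp add: dist_norm)
  qed
  moreover have "h 0 = 0" by (simp add: h_def)
  ultimately have "orthogonal_transformation h" unfolding orthogonal_transformation_isometry by blast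
  moreover have "f = (\<lambda>x. f 0 + k *\<^sub>R h x)" using assms(2) by (auto simp: h_def)
  ultimately show thesis by (rule that)
qed

lemma measure_similarity:
  fixes f :: "point \<Rightarrow> point"
  assumes "\<And>x y. dist (f x) (f y) = k * dist x y" "k > 0" "finite S"
  shows "measure lebesgue (convex hull (f ` S)) = k\<^sup>2 * measure lebesgue (convex hull S)"
proof -
  obtain h where h: "orthogonal_transformation h" "f = (\<lambda>x. f 0 + k *\<^sub>R h x)" by (rule similarity_form[OF assms(1,2)])
  have "f ` S = (\<lambda>x. f 0 + k *\<^sub>R x) ` h ` S" by (subst h(2)) (simp add: image_image)
  then have "convex hull (f ` S) = (\<lambda>x. f 0 + k *\<^sub>R x) ` h ` (convex hull S)"
    using convex_hull_linear_image[OF orthogonal_transformation_linear[OF h(1)]]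
    by (simp add: convex_hull_affinity)
  also have "(\<lambda>x. f 0 + k *\<^sub>R x) = (\<lambda>x. k *\<^sub>R x + f 0)" by (simp add: add.commute)
  also have "measure lebesgue (\<dots> ` h ` (convex hull S)) = k\<^sup>2 * measure lebesgue (h ` (convex hull S))"
    using measure_lebesgue_affine[of k "f 0" "h ` (convex hull S)"] assms(2) by simp
  also have "measure lebesgue (h ` (convex hull S)) = measure lebesgue (convex hull S)"
    using assms(3) by (intro measure_orthogonal_image h(1) lmeasurable_compact finite_imp_compact_convex_hull)
  finally show ?thesis .
qed

lemma noncollinear_similarity:
  fixes f :: "point \<Rightarrow> point"
  assumes "\<And>x y. dist (f x) (f y) = k * dist x y" "k > 0" "\<not> collinear S"
  shows "\<not> collinear (f ` S)"
proof
  assume "collinear (f ` S)"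
  obtain h where h: "orthogonal_transformation h" "f = (\<lambda>x. f 0 + k *\<^sub>R h x)" by (rule similarity_form[OF assms(1,2)])
  obtain w where w: "\<And>x y. x \<in> f ` S \<Longrightarrow> y \<in> f ` S \<Longrightarrow> \<exists>c. x - y = c *\<^sub>R w"
    using \<open>collinear (f ` S)\<close> unfolding collinear_def by blast
  obtain v where v: "w = h v" using orthogonal_transformation_surj[OF h(1)] by (metis surjD)
  have "collinear S" unfolding collinear_def
  proof (intro exI[of _ v] ballI)
    fix x y assume "x \<in> S" "y \<in> S"
    then obtain c where "f x - f y = c *\<^sub>R w" using w by blast
    moreover have "f x - f y = k *\<^sub>R h (x - y)"
      unfolding linear_diff[OF orthogonal_transformation_linear[OF h(1)]]
      by (subst (1 2) h(2)) (simp add: algebra_simps)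
    ultimately have "(1 / k) *\<^sub>R (k *\<^sub>R h (x - y)) = (1 / k) *\<^sub>R (c *\<^sub>R h v)" using v by simp
    then have "h (x - y) = h ((c / k) *\<^sub>R v)"
      using assms(2) by (simp add: linear_scale[OF orthogonal_transformation_linear[OF h(1)]])
    then have "x - y = (c / k) *\<^sub>R v" using orthogonal_transformation_inj[OF h(1)] by (simp add: inj_eq)
    then show "\<exists>c. x - y = c *\<^sub>R v" ..
  qed
  then show False using assms(3) by contradiction
qed

lemma measure_triangle_pos:
  assumes "is_triangle T"
  shows "measure lebesgue (convex hull T) > 0"
proof -
  obtain p q r where T: "T = {p, q, r}" using assms by (auto simp: is_triangle_def card_3_iff)
  have "\<not> negligible (convex hull T)"
    using noncollinear_triangle_interior[of p q r] assms unfolding T is_triangle_def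
    by (metis convex_convex_hull negligible_convex_interior)
  moreover have "convex hull T \<in> lmeasurable"
    unfolding T by (intro lmeasurable_compact finite_imp_compact_convex_hull) simp
  ultimately show ?thesis by (metis negligible_iff_measure0 zero_less_measure_iff)
qed

lemma tiling_area:
  assumes "is_tiling N \<T> T V" "is_triangle T" "f ` T = V" "\<And>x y. dist (f x) (f y) = k * dist x y" "k > 0"
  shows "real N = k\<^sup>2"
proof -
  have finT: "finite T" using assms(2) card.infinite by (force simp: is_triangle_def)
  have tile: "finite U" "measure lebesgue (convex hull U) = measure lebesgue (convex hull T)" if "U \<in> \<T>" for U
  proof -
    have "congruent T U" using assms(1) \<open>U \<in> \<T>\<close> by (simp add: is_tiling_def)
    then obtain g where "\<forall>x y. dist (g x) (g y) = dist x y" and gT: "g ` T = U"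
      unfolding congruent_def by blast
    then have g: "dist (g x) (g y) = 1 * dist x y" "g ` T = U" for x y by simp_all
    then show "finite U" using finT by auto
    show "measure lebesgue (convex hull U) = measure lebesgue (convex hull T)"
      using measure_similarity[OF g(1) _ finT] g(2) by simp
  qed
  have "measure lebesgue (\<Union>((\<lambda>U. convex hull U) ` \<T>)) = (\<Sum>U\<in>\<T>. measure lebesgue (convex hull U))"
  proof (rule measure_negligible_finite_Union_image)
    show "finite \<T>" using assms(1) by (simp add: is_tiling_def)
    show "convex hull U \<in> lmeasurable" if "U \<in> \<T>" for U
      using tile(1)[OF that] by (intro lmeasurable_compact finite_imp_compact_convex_hull)
    show "pairwise (\<lambda>U W. negligible (convex hull U \<inter> convex hull W)) \<T>"
    proof (rule pairwiseI)
      fix U W assume "U \<in> \<T>" "W \<in> \<T>" "U \<noteq> W"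
      then have "interior (convex hull U \<inter> convex hull W) = {}"
        using assms(1) unfolding is_tiling_def pairwise_def by simp
      then show "negligible (convex hull U \<inter> convex hull W)"
        by (simp add: negligible_convex_interior convex_Int)
    qed
  qed
  also have "\<dots> = real N * measure lebesgue (convex hull T)"
    using tile(2) assms(1) by (simp add: is_tiling_def)
  also have "\<Union>((\<lambda>U. convex hull U) ` \<T>) = convex hull V" using assms(1) by (simp add: is_tiling_def)
  also have "measure lebesgue (convex hull V) = k\<^sup>2 * measure lebesgue (convex hull T)"
    using measure_similarity[OF assms(4,5) finT] assms(3) by simp
  finally show ?thesis using measure_triangle_pos[OF assms(2)] by simp
qed

text \<open>Let \<open>t\<close> and \<open>t'\<close> be the polar angles of \<open>C\<close> seen
  from \<open>A\<close> and from \<open>B\<close>. The angles of the triangle are \<open>t\<close>,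
  \<open>pi - t'\<close> and \<open>t' - t\<close>, which makes their sum evident, and the height of
  \<open>C\<close> computed from both ends is the law of sines.\<close>

lemma (in chart) chart_triangle:
  assumes B: "B = A + L *\<^sub>R u" and "L > 0" and C: "(C - A) \<bullet> n > 0"
  shows "angle B A C > 0" "angle A B C > 0" "angle A C B > 0" "angle B A C + angle A B C + angle A C B = pi"
    "dist A C * sin (angle B A C) = dist B C * sin (angle A B C)"
proof -
  have "C - A \<noteq> 0" using C by auto
  then obtain t q where t: "0 \<le> t" "t \<le> pi" "q > 0" "C - A = q *\<^sub>R e t"
    by (rule polar[OF _ less_imp_le[OF C]])
  have CB: "(C - B) \<bullet> n > 0" using C by (simp add: B inner_diff_left inner_add_left)
  then have "C - B \<noteq> 0" by auto
  then obtain t' r where t': "0 \<le> t'" "t' \<le> pi" "r > 0" "C - B = r *\<^sub>R e t'"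
    by (rule polar[OF _ less_imp_le[OF CB]])
  have "q * sin t > 0" using C unfolding t(4) by simp
  then have st: "sin t > 0" using t(3) by (simp add: zero_less_mult_iff)
  have "r * sin t' > 0" using CB unfolding t'(4) by simp
  then have st': "sin t' > 0" using t'(3) by (simp add: zero_less_mult_iff)
  have t0: "0 < t" "t < pi" using st t by (metis less_eq_real_def less_irrefl sin_zero sin_pi)+
  have t0': "0 < t'" "t' < pi" using st' t' by (metis less_eq_real_def less_irrefl sin_zero sin_pi)+
  have e0: "e 0 = u" "e pi = - u" by (simp_all add: e_def)
  have "r *\<^sub>R e t' = q *\<^sub>R e t - L *\<^sub>R u" unfolding t(4)[symmetric] t'(4)[symmetric] B by (simp add: algebra_simps)
  then have "(1 / r) *\<^sub>R (r *\<^sub>R e t') = (1 / r) *\<^sub>R (q *\<^sub>R e t - L *\<^sub>R u)" by simp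
  then have "e t' = (q / r) *\<^sub>R e t + (- L / r) *\<^sub>R e 0" using t'(3) by (simp add: e0 algebra_simps)
  from sin_comb(1)[OF this] have "sin (t' - t) = (L / r) * sin t" by simp
  then have "sin (t' - t) > 0" using st t'(3) \<open>L > 0\<close> by simp
  moreover have "sin (t - t') = - sin (t' - t)" by (metis minus_diff_eq sin_minus)
  moreover have "sin (t - t') \<ge> 0" if "t' \<le> t" using that t0 t0' by (intro sin_ge_zero) auto
  ultimately have tt': "t < t'" by force
  have CA: "C = A + q *\<^sub>R e t" using t(4) by (simp add: algebra_simps)
  have CB': "C = B + r *\<^sub>R e t'" using t'(4) by (simp add: algebra_simps)
  have "B = A + L *\<^sub>R e 0" by (simp add: e0 B)
  then have \<alpha>: "angle B A C = t" using angle_e[of L q 0 t A] t \<open>L > 0\<close> CA by simp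
  have "A = B + L *\<^sub>R e pi" by (simp add: e0 B)
  then have \<beta>: "angle A B C = pi - t'" using angle_e[of L r pi t' B] t' \<open>L > 0\<close> CB' by simp
  have "e (x + pi) = - e x" for x by (simp add: e_def)
  then have "C + q *\<^sub>R e (t + pi) = C - q *\<^sub>R e t" "C + r *\<^sub>R e (t' + pi) = C - r *\<^sub>R e t'" by simp_all
  moreover have "C - q *\<^sub>R e t = A" unfolding CA by simp
  moreover have "C - r *\<^sub>R e t' = B" unfolding CB' by simp
  ultimately have "A = C + q *\<^sub>R e (t + pi)" "B = C + r *\<^sub>R e (t' + pi)" by simp_all
  then have \<gamma>: "angle A C B = t' - t" using angle_e[of q r "t + pi" "t' + pi" C] t t' tt' t0 t0' by simp
  show "angle B A C > 0" "angle A B C > 0" "angle A C B > 0" "angle B A C + angle A B C + angle A C B = pi"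
    unfolding \<alpha> \<beta> \<gamma> using t0 t0' tt' by simp_all
  have "q * sin t = r * sin t'"
    using arg_cong[OF \<open>r *\<^sub>R e t' = _\<close>, of "\<lambda>v. v \<bullet> n"] by (simp add: inner_diff_left)
  moreover have "dist A C = q" "dist B C = r" using t(3,4) t'(3,4) by (simp_all add: dist_norm norm_minus_commute[of _ C])
  ultimately show "dist A C * sin (angle B A C) = dist B C * sin (angle A B C)" unfolding \<alpha> \<beta> by simp
qed

lemma triangle_trig:
  assumes "\<not> collinear {A, B, C}"
  shows "angle B A C > 0" "angle A B C > 0" "angle A C B > 0" "angle B A C + angle A B C + angle A C B = pi"
    "dist A C * sin (angle B A C) = dist B C * sin (angle A B C)"
proof -
  obtain u n where "chart u n" "B = A + dist A B *\<^sub>R u" "(C - A) \<bullet> n > 0" using chart_exists[OF assms] by metis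
  moreover have "dist A B > 0" using assms by auto
  ultimately show "angle B A C > 0" "angle A B C > 0" "angle A C B > 0" "angle B A C + angle A B C + angle A C B = pi"
    "dist A C * sin (angle B A C) = dist B C * sin (angle A B C)"
    using chart.chart_triangle by metis+
qed

text \<open>Serves the ties between angles: an angle found at a corner then does not tell which
  vertex of the tile lies there, but the sides in question agree.\<close>

lemma isosceles:
  assumes "\<not> collinear {A, B, C}" "angle B A C = angle A B C"
  shows "dist A C = dist B C"
proof -
  have "0 < angle B A C" "angle B A C < pi" using triangle_trig[OF assms(1)] by linarith+
  then have "sin (angle B A C) > 0" by (rule sin_gt_zero)
  then show ?thesis using triangle_trig(5)[OF assms(1)] assms(2) by simp
qed

lemma right_triangle_trig:
  assumes "\<not> collinear {A, B, C}" "angle A C B = pi / 2"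
  shows "dist B C = dist A B * sin (angle B A C)" "dist A C = dist A B * cos (angle B A C)"
proof -
  have "\<not> collinear {A, C, B}" "\<not> collinear {B, C, A}" using assms(1) by (simp_all add: insert_commute)
  note 1 = triangle_trig(5)[OF this(1)] and 2 = triangle_trig(5)[OF this(2)]
  have "angle A B C = pi / 2 - angle B A C" using triangle_trig(4)[OF assms(1)] assms(2) by simp
  then have "sin (angle A B C) = cos (angle B A C)" by (simp add: sin_cos_eq)
  then show "dist B C = dist A B * sin (angle B A C)" "dist A C = dist A B * cos (angle B A C)"
    using 1 2 assms(2) angle_commute[of C A B] angle_commute[of C B A] angle_commute[of B C A]
    by (simp_all add: dist_commute)
qed

section \<open>Tilings by a similar triangle\<close>

text \<open>What is kept of congruence: some labelling of the unordered tile has the prescribed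
  sides, each opposite to the angle of the corresponding name.\<close>

definition shape :: "real \<Rightarrow> real \<Rightarrow> real \<Rightarrow> real \<Rightarrow> real \<Rightarrow> real \<Rightarrow> point set \<Rightarrow> bool" where
  "shape a b c \<alpha> \<beta> \<gamma> U \<longleftrightarrow> (\<exists>P Q R. U = {P, Q, R} \<and> card U = 3 \<and> dist Q R = a \<and> dist P R = b \<and> dist P Q = c \<and>
     vangle U P = \<alpha> \<and> vangle U Q = \<beta> \<and> vangle U R = \<gamma>)"

lemma shape_swap:
  assumes "shape a b c \<alpha> \<beta> \<gamma> U"
  shows "shape b a c \<beta> \<alpha> \<gamma> U" "shape a c b \<alpha> \<gamma> \<beta> U"
proof -
  obtain P Q R where "U = {P, Q, R}" "card U = 3" "dist Q R = a" "dist P R = b" "dist P Q = c"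
    "vangle U P = \<alpha>" "vangle U Q = \<beta>" "vangle U R = \<gamma>" using assms unfolding shape_def by blast
  moreover from this have "U = {Q, P, R}" "U = {P, R, Q}" by auto
  ultimately show "shape b a c \<beta> \<alpha> \<gamma> U" "shape a c b \<alpha> \<gamma> \<beta> U"
    unfolding shape_def by (metis dist_commute)+
qed

lemma shape_edge:
  assumes "shape a b c \<alpha> \<beta> \<gamma> U" "card (U \<inter> S) = 2"
  shows "pair_dist (U \<inter> S) \<in> {a, b, c}"
proof -
  obtain P Q R where U: "U = {P, Q, R}" "dist Q R = a" "dist P R = b" "dist P Q = c"
    using assms unfolding shape_def by blast
  obtain x y where xy: "U \<inter> S = {x, y}" "x \<noteq> y" using assms(2) unfolding card_2_iff by blast
  then have "x \<in> {P, Q, R}" "y \<in> {P, Q, R}" using U by blast+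
  then show ?thesis using U xy by (auto simp: dist_commute)
qed

text \<open>A vertex with angle \<open>\<alpha>\<close> need not carry the label belonging to
  \<open>\<alpha>\<close>. If it carries another one, two angles coincide, and equality of the
  opposite sides restores the conclusion.\<close>

lemma shape_corner:
  assumes "shape a b c \<alpha> \<beta> \<gamma> U" "\<alpha> = \<beta> \<Longrightarrow> a = b" "\<alpha> = \<gamma> \<Longrightarrow> a = c"
    and XYZ: "U = {X, Y, Z}" "vangle U X = \<alpha>"
  shows "dist X Y = b \<and> dist X Z = c \<or> dist X Y = c \<and> dist X Z = b"
proof -
  obtain P Q R where U: "U = {P, Q, R}" "card U = 3" "dist Q R = a" "dist P R = b" "dist P Q = c"
    and v: "vangle U P = \<alpha>" "vangle U Q = \<beta>" "vangle U R = \<gamma>" using assms(1) unfolding shape_def by blast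
  have d: "X \<noteq> Y" "X \<noteq> Z" "Y \<noteq> Z" using U(2) XYZ(1) by (auto simp: card_insert_if split: if_splits)
  have "P \<noteq> Q" "P \<noteq> R" "Q \<noteq> R" using U(1,2) by (auto simp: card_insert_if split: if_splits)
  have eq: "{X, Y, Z} = {P, Q, R}" using U XYZ by simp
  have YZ: "{Y, Z} = {P, Q, R} - {X}" unfolding eq[symmetric] using d by auto
  have "X \<in> {P, Q, R}" using eq by blast
  then consider "X = P" "{Y, Z} = {Q, R}" | "X = Q" "{Y, Z} = {P, R}" | "X = R" "{Y, Z} = {P, Q}"
    using YZ \<open>P \<noteq> Q\<close> \<open>P \<noteq> R\<close> \<open>Q \<noteq> R\<close> by force
  then show ?thesis
  proof cases
    case 1
    then show ?thesis using U by (auto simp: doubleton_eq_iff)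
  next
    case 2
    then have "a = b" using assms(2) v XYZ(2) by simp
    then show ?thesis using 2 U by (auto simp: doubleton_eq_iff dist_commute)
  next
    case 3
    then have "a = c" using assms(3) v XYZ(2) by simp
    then show ?thesis using 3 U by (auto simp: doubleton_eq_iff dist_commute)
  qed
qed

text \<open>Only which lengths occur on a side, without multiplicities: this is all that the
  argument about signs depends on.\<close>

definition side_lengths :: "point set set \<Rightarrow> point \<Rightarrow> point \<Rightarrow> real set" where
  "side_lengths \<T> X Y = (\<lambda>U. pair_dist (U \<inter> closed_segment X Y)) ` {U\<in>\<T>. card (U \<inter> closed_segment X Y) = 2}"

lemma side_lengths_commute: "side_lengths \<T> X Y = side_lengths \<T> Y X"
  by (simp add: side_lengths_def closed_segment_commute)

text \<open>No order of the angles is assumed, so that all data may be permuted together and results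
  for one corner or side transfer to the others.\<close>

locale similar_tiling = triangle_tiling +
  fixes a b c \<alpha> \<beta> \<gamma> s :: real
  assumes sides: "dist B C = s * a" "dist A C = s * b" "dist A B = s * c"
    and angles: "angle B A C = \<alpha>" "angle A B C = \<beta>" "angle A C B = \<gamma>"
    and shape: "U \<in> \<T> \<Longrightarrow> shape a b c \<alpha> \<beta> \<gamma> U"
    and iso: "\<alpha> = \<beta> \<Longrightarrow> a = b" "\<alpha> = \<gamma> \<Longrightarrow> a = c" "\<beta> = \<gamma> \<Longrightarrow> b = c"
    and pos: "a > 0" "b > 0" "c > 0" "\<alpha> > 0" "\<beta> > 0" "\<gamma> > 0"
begin

lemma similar_swap: "similar_tiling B A C \<T> b a c \<beta> \<alpha> \<gamma> s" "similar_tiling A C B \<T> a c b \<alpha> \<gamma> \<beta> s"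
proof -
  show "similar_tiling B A C \<T> b a c \<beta> \<alpha> \<gamma> s"
    by (intro similar_tiling.intro similar_tiling_axioms.intro swap)
      (use sides angles shape_swap(1)[OF shape] iso pos in \<open>simp_all add: dist_commute angle_commute\<close>)
  show "similar_tiling A C B \<T> a c b \<alpha> \<gamma> \<beta> s"
    by (intro similar_tiling.intro similar_tiling_axioms.intro swap)
      (use sides angles shape_swap(2)[OF shape] iso pos in \<open>simp_all add: dist_commute angle_commute\<close>)
qed

lemma side_list:
  obtains L where "set L = side_lengths \<T> A B" "set L \<subseteq> {a, b, c}" "sum_list L = s * c"
proof -
  define E where "E = {U\<in>\<T>. card (U \<inter> closed_segment A B) = 2}"
  have "finite E" using finite_tiles by (simp add: E_def)
  then obtain us where us: "set us = E" "distinct us" using finite_distinct_list by blast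
  define L where "L = map (\<lambda>U. pair_dist (U \<inter> closed_segment A B)) us"
  have "sum_list L = s * c"
    using side_sum sides(3) us unfolding L_def E_def[symmetric] by (simp add: sum_list_distinct_conv_sum_set)
  moreover have "set L = side_lengths \<T> A B" using us by (simp add: L_def side_lengths_def E_def)
  moreover have "set L \<subseteq> {a, b, c}"
  proof
    fix y assume "y \<in> set L"
    then obtain U where "U \<in> E" "y = pair_dist (U \<inter> closed_segment A B)" using us by (auto simp: L_def)
    then show "y \<in> {a, b, c}" using shape_edge[OF shape, of U] by (simp add: E_def)
  qed
  ultimately show thesis using that by blast
qed

lemma vertex_angles:
  assumes "U \<in> \<T>" "P \<in> U"
  shows "vangle U P \<in> {\<alpha>, \<beta>, \<gamma>}" "vangle U P > 0"
proof -
  show "vangle U P \<in> {\<alpha>, \<beta>, \<gamma>}" using shape[OF assms(1)] assms(2) unfolding shape_def by auto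
  then show "vangle U P > 0" using pos by auto
qed

lemma corner_finite: "finite {U\<in>\<T>. P \<in> U}"
  using finite_tiles by simp

lemma corner_angle_le:
  assumes "U \<in> \<T>" "A \<in> U"
  shows "vangle U A \<le> \<alpha>"
proof -
  have "vangle U A \<le> (\<Sum>U\<in>{U\<in>\<T>. A \<in> U}. vangle U A)"
    using assms vertex_angles(2) less_imp_le by (intro member_le_sum corner_finite) auto
  then show ?thesis using corner_angles angles by simp
qed

lemma corner_angle_less:
  assumes "U \<in> \<T>" "A \<in> U" "card {U\<in>\<T>. A \<in> U} \<ge> 2"
  shows "vangle U A < \<alpha>"
proof -
  have "{U\<in>\<T>. A \<in> U} \<noteq> {U}" using assms(3) by (metis Suc_1 card_1_singleton_iff One_nat_def not_less_eq_eq order_refl)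
  then obtain W where W: "W \<in> \<T>" "A \<in> W" "W \<noteq> U" using assms(1,2) by blast
  have "(\<Sum>U\<in>{U, W}. vangle U A) \<le> (\<Sum>U\<in>{U\<in>\<T>. A \<in> U}. vangle U A)"
    using assms W vertex_angles(2) less_imp_le by (intro sum_mono2 corner_finite) auto
  then have "vangle U A + vangle W A \<le> \<alpha>" using corner_angles angles W(3) by simp
  then show ?thesis using vertex_angles(2)[OF W(1,2)] by linarith
qed

text \<open>The only tile at \<open>A\<close> has the full angle \<open>\<alpha>\<close> there, so
  its edges at \<open>A\<close> are \<open>b\<close> and \<open>c\<close>. Either may lie on either
  side, since the tile may be reflected.\<close>

lemma unsplit_sides:
  assumes "\<not> card {U\<in>\<T>. A \<in> U} \<ge> 2"
  shows "b \<in> side_lengths \<T> A C \<and> c \<in> side_lengths \<T> A B \<or> c \<in> side_lengths \<T> A C \<and> b \<in> side_lengths \<T> A B"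
proof -
  have "{U\<in>\<T>. A \<in> U} \<noteq> {}" using side_start by blast
  then have "card {U\<in>\<T>. A \<in> U} \<noteq> 0" using corner_finite by simp
  then have "card {U\<in>\<T>. A \<in> U} = 1" using assms by simp
  then obtain U where U: "{U\<in>\<T>. A \<in> U} = {U}" by (rule card_1_singletonE)
  then have "U \<in> {U\<in>\<T>. A \<in> U}" by simp
  then have "U \<in> \<T>" by simp
  obtain Q R where QR: "U = {A, Q, R}" "U \<inter> closed_segment A B = {A, Q}" "U \<inter> closed_segment A C = {A, R}"
    "A \<noteq> Q" "A \<noteq> R" by (rule unsplit_corner[OF U])
  have "vangle U A = \<alpha>" using corner_angles angles unfolding U by simp
  then have "dist A Q = b \<and> dist A R = c \<or> dist A Q = c \<and> dist A R = b"
    using shape_corner[OF shape[OF \<open>U \<in> \<T>\<close>] iso(1,2) QR(1)] by blast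
  moreover have "dist A Q \<in> side_lengths \<T> A B" unfolding side_lengths_def
    by (rule image_eqI[of _ _ U]) (use QR \<open>U \<in> \<T>\<close> in simp_all)
  moreover have "dist A R \<in> side_lengths \<T> A C" unfolding side_lengths_def
    by (rule image_eqI[of _ _ U]) (use QR \<open>U \<in> \<T>\<close> in simp_all)
  ultimately show ?thesis by auto
qed

text \<open>No tile has its longest edge on \<open>A B\<close>, so every tile along \<open>A B\<close> has its \<open>\<gamma>\<close>-vertex there, but
  never at \<open>A\<close> or \<open>B\<close>. Hence two of these vertices coincide, and \<open>2 \<gamma> < pi\<close> would leave
  an angle smaller than \<open>\<alpha>\<close> to be filled.\<close>

lemma two_largest_angles:
  assumes \<gamma>: "\<beta> < \<gamma>" "\<alpha> \<le> \<beta>" and c: "c \<notin> side_lengths \<T> A B" and sum: "\<alpha> + \<beta> + \<gamma> = pi"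
  shows "\<gamma> = pi / 2"
proof -
  have "\<forall>U\<in>\<T>. \<exists>P Q R. U = {P, Q, R} \<and> dist P Q = c \<and> vangle U R = \<gamma>"
    using shape unfolding shape_def by blast
  then have "\<forall>U\<in>\<T>. \<exists>R. R \<in> U \<and> (\<exists>P Q. U = {P, Q, R} \<and> dist P Q = c) \<and> vangle U R = \<gamma>" by blast
  from bchoice[OF this] obtain m where
    m: "\<forall>U\<in>\<T>. m U \<in> U \<and> (\<exists>P Q. U = {P, Q, m U} \<and> dist P Q = c) \<and> vangle U (m U) = \<gamma>" ..
  interpret swapped: similar_tiling B A C \<T> b a c \<beta> \<alpha> \<gamma> s by (rule similar_swap)
  have on_side: "m U \<in> U \<inter> closed_segment A B - {A, B}" if U: "U \<in> \<T>" "card (U \<inter> closed_segment A B) = 2" for U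
  proof -
    \<comment> \<open>Tile angles at \<open>A\<close> and \<open>B\<close> are at most
      \<open>\<alpha>\<close> and \<open>\<beta>\<close>, both smaller than
      \<open>\<gamma>\<close>.\<close>
    have "m U \<noteq> A" using corner_angle_le[OF U(1)] m U(1) \<gamma> by force
    moreover have "m U \<noteq> B" using swapped.corner_angle_le[OF U(1)] m U(1) \<gamma> by force
    moreover have "m U \<in> closed_segment A B"
    proof (rule ccontr)
      \<comment> \<open>Otherwise the edge of the tile on the side would be the one opposite to
        \<open>m U\<close>, of length \<open>c\<close>.\<close>
      assume n: "m U \<notin> closed_segment A B"
      obtain P Q where PQ: "U = {P, Q, m U}" "dist P Q = c" using m U(1) by blast
      obtain x y where xy: "U \<inter> closed_segment A B = {x, y}" "x \<noteq> y" using U(2) unfolding card_2_iff by blast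
      then have "x \<in> {P, Q, m U} - {m U}" "y \<in> {P, Q, m U} - {m U}" using n PQ(1) by blast+
      then have "{x, y} = {P, Q}" using xy(2) by auto
      then have "pair_dist (U \<inter> closed_segment A B) = c" using xy(1) PQ(2) by simp
      then have "c \<in> side_lengths \<T> A B" using U unfolding side_lengths_def by (intro image_eqI[of _ _ U]) auto
      then show False using c by contradiction
    qed
    ultimately show ?thesis using m U(1) by blast
  qed
  obtain U W where UW: "U \<in> \<T>" "W \<in> \<T>" "U \<noteq> W" "card (U \<inter> closed_segment A B) = 2" "m U = m W"
    by (rule side_pigeonhole[OF on_side])
  define P where "P = m U"
  have P: "P \<in> U" "P \<in> W" "vangle U P = \<gamma>" "vangle W P = \<gamma>" using UW m unfolding P_def by metis+
  have "P \<in> open_segment A B" using on_side[OF UW(1,4)] unfolding P_def open_segment_def by blast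
  then have total: "(\<Sum>U\<in>{U\<in>\<T>. P \<in> U}. vangle U P) = pi" using straight_angles UW(1) P(1) by blast
  show ?thesis
  proof (cases "{U\<in>\<T>. P \<in> U} = {U, W}")
    case True
    then show ?thesis using total UW(3) P by simp
  next
    \<comment> \<open>A third tile at this point would give
      \<open>2 * \<gamma> + \<alpha> \<le> pi\<close>, which with the angle sum contradicts
      \<open>\<beta> < \<gamma>\<close>.\<close>
    case False
    then obtain X where X: "X \<in> \<T>" "P \<in> X" "X \<noteq> U" "X \<noteq> W" using UW P by blast
    have "(\<Sum>U\<in>{U, W, X}. vangle U P) \<le> (\<Sum>U\<in>{U\<in>\<T>. P \<in> U}. vangle U P)"
      using UW P X vertex_angles(2) less_imp_le by (intro sum_mono2 corner_finite) auto
    then have "\<gamma> + \<gamma> + vangle X P \<le> pi" using total UW(3) X P by simp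
    moreover have "vangle X P \<ge> \<alpha>" using vertex_angles(1)[OF X(1,2)] \<gamma> by auto
    ultimately show ?thesis using sum \<gamma> by linarith
  qed
qed

text \<open>Each tile at a split corner has an angle strictly below that of the corner, and only
  \<open>\<alpha>\<close> can be below \<open>\<beta>\<close>.\<close>

lemma split_middle_angle:
  assumes "\<alpha> \<le> \<beta>" "\<beta> \<le> \<gamma>" "card {U\<in>\<T>. B \<in> U} \<ge> 2"
  shows "\<exists>k\<ge>2. \<beta> = real k * \<alpha>"
proof -
  interpret swapped: similar_tiling B A C \<T> b a c \<beta> \<alpha> \<gamma> s by (rule similar_swap)
  have "vangle U B = \<alpha>" if "U \<in> \<T>" "B \<in> U" for U
    using swapped.corner_angle_less[OF that assms(3)] vertex_angles(1)[OF that] assms by auto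
  then have "(\<Sum>U\<in>{U\<in>\<T>. B \<in> U}. vangle U B) = real (card {U\<in>\<T>. B \<in> U}) * \<alpha>" by simp
  then have "\<beta> = real (card {U\<in>\<T>. B \<in> U}) * \<alpha>" using swapped.corner_angles swapped.angles by simp
  then show ?thesis using assms(3) by blast
qed

lemma sorted_case:
  fixes N :: nat
  assumes order: "\<alpha> \<le> \<beta>" "\<beta> \<le> \<gamma>" and s: "s > 0" "s\<^sup>2 = real N" "s \<notin> \<rat>"
    and sum: "\<alpha> + \<beta> + \<gamma> = pi"
    and right: "\<gamma> = pi / 2 \<Longrightarrow> a = c * sin \<alpha>" "\<gamma> = pi / 2 \<Longrightarrow> b = c * cos \<alpha>"
  shows "\<gamma> = pi / 2 \<and> (\<alpha> = pi / 6 \<and> (\<exists>m::nat. N = 3 * m\<^sup>2) \<or>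
    splits_angle_at \<T> C \<and> (\<exists>x y::nat. N = x\<^sup>2 + y\<^sup>2 \<and> a / b = real x / real y))"
proof -
  interpret ba: similar_tiling B A C \<T> b a c \<beta> \<alpha> \<gamma> s by (rule similar_swap)
  interpret ac: similar_tiling A C B \<T> a c b \<alpha> \<gamma> \<beta> s by (rule similar_swap)
  interpret bc: similar_tiling B C A \<T> b c a \<beta> \<gamma> \<alpha> s by (rule ba.similar_swap)
  interpret ca: similar_tiling C A B \<T> c a b \<gamma> \<alpha> \<beta> s by (rule ac.similar_swap)
  obtain Lc where Lc: "set Lc = side_lengths \<T> A B" "set Lc \<subseteq> {a, b, c}" "sum_list Lc = s * c" by (rule side_list)
  obtain Lb where Lb: "set Lb = side_lengths \<T> A C" "set Lb \<subseteq> {a, c, b}" "sum_list Lb = s * b" by (rule ac.side_list)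
  obtain La where La: "set La = side_lengths \<T> B C" "set La \<subseteq> {b, c, a}" "sum_list La = s * a" by (rule bc.side_list)
  have Lb': "set Lb \<subseteq> {a, b, c}" and La': "set La \<subseteq> {a, b, c}" using La Lb by auto
  obtain \<sigma> :: "real \<Rightarrow> int" where \<sigma>: "\<And>x. \<sigma> x \<in> {-1, 0, 1}" "1 \<in> \<sigma> ` {a, b, c}" "-1 \<in> \<sigma> ` {a, b, c}"
    and opp: "\<And>x y L. x \<in> {a, b, c} \<Longrightarrow> set L \<subseteq> {a, b, c} \<Longrightarrow> sum_list L = s * x \<Longrightarrow> \<sigma> x \<noteq> 0 \<Longrightarrow> y \<in> set L \<Longrightarrow> \<sigma> y = - \<sigma> x"
  proof (rule sign_function[of s "{a, b, c}"])
    show "s > 0" "s \<notin> \<rat>" "s\<^sup>2 \<in> \<rat>" using s by simp_all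
    show "x > 0" if "x \<in> {a, b, c}" for x using that pos by auto
    show "\<exists>L. set L \<subseteq> {a, b, c} \<and> sum_list L = s * x" if "x \<in> {a, b, c}" for x
      using that Lc(2,3) Lb'  Lb(3) La' La(3) by blast
  qed auto
  have oppa: "\<sigma> y = - \<sigma> a" if "\<sigma> a \<noteq> 0" "y \<in> side_lengths \<T> B C" for y
    using opp[of a La y] La(1,3) La' that by simp
  have oppb: "\<sigma> y = - \<sigma> b" if "\<sigma> b \<noteq> 0" "y \<in> side_lengths \<T> A C" for y
    using opp[of b Lb y] Lb(1,3) Lb' that by simp
  have oppc: "\<sigma> y = - \<sigma> c" if "\<sigma> c \<noteq> 0" "y \<in> side_lengths \<T> A B" for y
    using opp[of c Lc y] Lc that by simp
  \<comment> \<open>At a split corner every tile angle would be smaller than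
    \<open>\<alpha>\<close>, the smallest angle of the tile.\<close>
  have "\<not> card {U\<in>\<T>. A \<in> U} \<ge> 2"
  proof
    assume split: "card {U\<in>\<T>. A \<in> U} \<ge> 2"
    obtain U where "U \<in> \<T>" "A \<in> U" using side_start by blast
    then show False using corner_angle_less[OF _ _ split] vertex_angles(1) order by fastforce
  qed
  from unsplit_sides[OF this] have "\<sigma> b \<noteq> 0 \<and> \<sigma> c = - \<sigma> b"
    using unsplit_corner_signs[of \<sigma> b c a, OF \<sigma>(1) _ _ oppb oppc] \<sigma>(2,3) by (simp add: insert_commute)
  then have bc: "\<sigma> b \<noteq> 0" "\<sigma> c = - \<sigma> b" by simp_all
  \<comment> \<open>Opposite signs exclude equal lengths, hence equal angles; this gives the strict
    inequality that the pigeonhole argument requires.\<close>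
  have "b \<noteq> c" using bc by auto
  then have "\<beta> \<noteq> \<gamma>" using iso(3) by blast
  then have "\<beta> < \<gamma>" using order by simp
  moreover have "c \<notin> side_lengths \<T> A B"
  proof
    assume "c \<in> side_lengths \<T> A B"
    moreover have "\<sigma> c \<noteq> 0" using bc by simp
    ultimately have "\<sigma> c = - \<sigma> c" by (intro oppc)
    then show False using bc by simp
  qed
  ultimately have \<gamma>: "\<gamma> = pi / 2" using two_largest_angles order sum by blast
  have splitB: "(\<exists>k\<ge>2. \<beta> = real k * \<alpha>) \<or> \<sigma> a = - \<sigma> c"
  proof (cases "card {U\<in>\<T>. B \<in> U} \<ge> 2")
    case False
    from ba.unsplit_sides[OF this] have "\<sigma> c = - \<sigma> a"
      using unsplit_corner_signs[of \<sigma> a c b, OF \<sigma>(1) _ _ oppa oppc] \<sigma>(2,3)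
      by (simp add: insert_commute side_lengths_commute[of _ B A])
    then show ?thesis by simp
  qed (use split_middle_angle order in blast)
  have splitC: "splits_angle_at \<T> C \<or> \<sigma> a = - \<sigma> b"
  proof (cases "card {U\<in>\<T>. C \<in> U} \<ge> 2")
    case False
    from ca.unsplit_sides[OF this] have "\<sigma> b = - \<sigma> a"
      using unsplit_corner_signs[of \<sigma> a b c, OF \<sigma>(1) _ _ oppa oppb] \<sigma>(2,3)
      by (simp add: side_lengths_commute[of _ C])
    then show ?thesis by simp
  qed (simp add: splits_angle_at_def)
  have "\<alpha> = pi / 6 \<and> (\<exists>m::nat. N = 3 * m\<^sup>2) \<or>
    splits_angle_at \<T> C \<and> (\<exists>x y::nat. N = x\<^sup>2 + y\<^sup>2 \<and> a / b = real x / real y)"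
  proof (rule right_triangle_sides[OF pos(1-3) s(1,2) bc La' La(3) _ Lb' Lb(3) _ Lc(2,3) _ \<sigma>(1) \<sigma>(1) right[OF \<gamma>] _ splitB splitC])
    show "\<sigma> y = - \<sigma> a" if "\<sigma> a \<noteq> 0" "y \<in> set La" for y using oppa that La(1) by simp
    show "\<sigma> y = - \<sigma> b" if "y \<in> set Lb" for y using oppb that Lb(1) bc by simp
    show "\<sigma> y = - \<sigma> c" if "y \<in> set Lc" for y using oppc that Lc(1) bc by simp
    show "\<alpha> + \<beta> = pi / 2" using sum \<gamma> by simp
  qed
  then show ?thesis using \<gamma> by blast
qed

end

section \<open>Irrational roots and the reduction to sorted angles\<close>

lemma nonsquare_root_irrational:
  fixes s :: real
  assumes "s\<^sup>2 = real N" "\<not> (\<exists>m::nat. N = m\<^sup>2)"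
  shows "s \<notin> \<rat>"
proof
  assume "s \<in> \<rat>"
  then obtain p q :: int where q: "q > 0" "coprime p q" and s: "s = of_int p / of_int q"
    using Rats_cases' by metis
  have "of_int (p\<^sup>2) = (of_int (int N * q\<^sup>2) :: real)"
    using assms(1) q unfolding s by (simp add: power_divide nonzero_divide_eq_eq)
  then have pq: "p\<^sup>2 = int N * q\<^sup>2" by (simp only: of_int_eq_iff)
  then have "q dvd p\<^sup>2" by (simp add: power2_eq_square)
  moreover have "coprime q (p\<^sup>2)" using q(2) by (simp add: coprime_commute)
  ultimately have "q = 1" using q(1) coprime_common_divisor[of q "p\<^sup>2" q] by auto
  then have "int N = int ((nat \<bar>p\<bar>)\<^sup>2)" using pq by simp
  then have "N = (nat \<bar>p\<bar>)\<^sup>2" by (simp only: of_nat_eq_iff)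
  then show False using assms(2) by blast
qed

lemma sqrt_3_irrational: "sqrt 3 \<notin> \<rat>"
proof (rule nonsquare_root_irrational[of _ 3])
  show "\<not> (\<exists>m::nat. 3 = m\<^sup>2)"
  proof
    assume "\<exists>m::nat. 3 = m\<^sup>2"
    then obtain m :: nat where m: "3 = m * m" by (auto simp: power2_eq_square)
    then have "m \<le> 1 \<or> m \<ge> 2" by linarith
    then show False
    proof
      assume "m \<ge> 2"
      then have "2 * 2 \<le> m * m" by (intro mult_mono) auto
      then show False using m by simp
    qed (use m in \<open>auto simp: le_Suc_eq\<close>)
  qed
qed simp

lemma sort_vertices:
  fixes g :: "point \<Rightarrow> real"
  shows "\<exists>X Y Z. {A, B, C} = {X, Y, Z} \<and> g X \<le> g Y \<and> g Y \<le> g Z"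
proof -
  have perms: "{A, B, C} = {A, C, B}" "{A, B, C} = {B, A, C}" "{A, B, C} = {B, C, A}" "{A, B, C} = {C, A, B}"
    "{A, B, C} = {C, B, A}" by auto
  consider "g A \<le> g B" "g B \<le> g C" | "g A \<le> g C" "g C \<le> g B" | "g B \<le> g A" "g A \<le> g C"
    | "g B \<le> g C" "g C \<le> g A" | "g C \<le> g A" "g A \<le> g B" | "g C \<le> g B" "g B \<le> g A" by linarith
  then show ?thesis using perms by cases blast+
qed

lemma similar_triangle_tiling:
  assumes V: "is_triangle {A, B, C}" and T: "is_triangle {A', B', C'}" and til: "is_tiling N \<T> {A', B', C'} {A, B, C}"
    and f: "\<And>x y. dist (f x) (f y) = k * dist x y" "k > 0" "f A' = A" "f B' = B" "f C' = C"
  shows "similar_tiling A B C \<T> (dist B' C') (dist A' C') (dist A' B') (angle B A C) (angle A B C) (angle A C B) k"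
proof -
  have nc: "\<not> collinear {A, B, C}" and nc': "\<not> collinear {A', B', C'}" using V T by (simp_all add: is_triangle_def)
  have ang: "angle B' A' C' = angle B A C" "angle A' B' C' = angle A B C" "angle A' C' B' = angle A C B"
    using angle_similarity[of f k B' A' C'] angle_similarity[of f k A' B' C'] angle_similarity[of f k A' C' B'] f by auto
  have tile: "card U = 3 \<and> \<not> collinear U \<and>
      shape (dist B' C') (dist A' C') (dist A' B') (angle B A C) (angle A B C) (angle A C B) U" if "U \<in> \<T>" for U
  proof -
    have "congruent {A', B', C'} U" using til that by (simp add: is_tiling_def)
    then obtain g where g: "\<forall>x y. dist (g x) (g y) = dist x y" and U: "U = {g A', g B', g C'}"
      unfolding congruent_def by auto
    then have g': "dist (g x) (g y) = 1 * dist x y" for x y by simp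
    have "\<not> collinear U" using noncollinear_similarity[OF g' _ nc'] U by simp
    moreover have "g A' \<noteq> g B'" "g A' \<noteq> g C'" "g B' \<noteq> g C'"
      using nc' g by (metis dist_eq_0_iff insert_absorb2 collinear_2 insert_commute)+
    then have card: "card U = 3" by (simp add: U)
    moreover have "vangle U (g A') = angle B' A' C'"
      using vangle_eq[OF U card] angle_similarity[OF g', of B' A' C'] by simp
    moreover have "vangle U (g B') = angle A' B' C'"
      using vangle_eq[of U "g B'" "g A'" "g C'", OF _ card] angle_similarity[OF g', of A' B' C']
      by (simp add: U insert_commute)
    moreover have "vangle U (g C') = angle A' C' B'"
      using vangle_eq[of U "g C'" "g A'" "g B'", OF _ card] angle_similarity[OF g', of A' C' B']
      by (simp add: U insert_commute)
    ultimately show ?thesis unfolding shape_def ang[symmetric] using g U by blast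
  qed
  have "A' \<noteq> B'" "A' \<noteq> C'" "B' \<noteq> C'" using nc' by (auto simp: insert_commute)
  show ?thesis
  proof unfold_locales
    show "\<not> collinear {A, B, C}" by fact
    show "finite \<T>" "(\<Union>U\<in>\<T>. convex hull U) = convex hull {A, B, C}" using til by (simp_all add: is_tiling_def)
    show "interior (convex hull U) \<inter> interior (convex hull W) = {}" if "U \<in> \<T>" "W \<in> \<T>" "U \<noteq> W" for U W
      using til that by (auto simp: is_tiling_def pairwise_def)
    show "dist B C = k * dist B' C'" "dist A C = k * dist A' C'" "dist A B = k * dist A' B'" using f by metis+
    have nc'': "\<not> collinear {A', C', B'}" "\<not> collinear {B', C', A'}" using nc' by (simp_all add: insert_commute)
    show "dist B' C' = dist A' C'" if "angle B A C = angle A B C"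
      using isosceles[OF nc'] ang that by simp
    show "dist B' C' = dist A' B'" if "angle B A C = angle A C B"
      using isosceles[OF nc''(1)] ang that angle_commute by (simp add: dist_commute)
    show "dist A' C' = dist A' B'" if "angle A B C = angle A C B"
      using isosceles[OF nc''(2)] ang that angle_commute by (simp add: dist_commute)
    show "0 < angle B A C" "0 < angle A B C" "0 < angle A C B" using triangle_trig[OF nc] by simp_all
  qed (use tile \<open>A' \<noteq> B'\<close> \<open>A' \<noteq> C'\<close> \<open>B' \<noteq> C'\<close> in auto)
qed

text \<open>The similarity carries the angles of the tile to \<open>V\<close>. In the first
  alternative the tangents of the acute angles of \<open>V\<close> are \<open>1 / sqrt 3\<close> and
  \<open>sqrt 3\<close>, while the second requires a rational one.\<close>

lemma alternatives_exclusive: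
  assumes V: "is_triangle V" and f: "\<And>x y. dist (f x) (f y) = k * dist x y" "k > 0" "f ` T = V"
  shows "\<not> (three_times_square_case N T \<and> sum_of_squares_case N \<T> V)"
proof
  assume "three_times_square_case N T \<and> sum_of_squares_case N \<T> V"
  then obtain P Q R X Y Z and e g :: int where T: "T = {P, Q, R}" "angle Q P R = pi / 6" "angle P Q R = pi / 3" "angle P R Q = pi / 2"
    and XYZ: "V = {X, Y, Z}" "angle X Z Y = pi / 2" "tan (angle Y X Z) = of_int e / of_int g"
    unfolding three_times_square_case_def is_30_60_90_triangle_def sum_of_squares_case_def by blast
  have card: "card V = 3" using V by (simp add: is_triangle_def)
  have VT: "V = {f P, f Q, f R}" using f(3) T(1) by auto
  have v: "vangle V (f P) = pi / 6" "vangle V (f Q) = pi / 3" "vangle V (f R) = pi / 2"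
    using vangle_eq[of V "f P" "f Q" "f R", OF VT card] vangle_eq[of V "f Q" "f P" "f R"] vangle_eq[of V "f R" "f P" "f Q"] card
      angle_similarity[of f k, OF f(1,2)] T VT by (auto simp: insert_commute)
  have w: "vangle V Z = pi / 2" "vangle V X = angle Y X Z"
    using vangle_eq[of V Z X Y] vangle_eq[of V X Y Z] card XYZ by (auto simp: insert_commute)
  have "Z \<in> {f P, f Q, f R}" "X \<in> {f P, f Q, f R}" using VT XYZ(1) by auto
  moreover have "X \<noteq> Z" using card XYZ(1) by (auto simp: card_insert_if split: if_splits)
  moreover have "pi / 6 \<noteq> pi / 2" "pi / 3 \<noteq> pi / 2" by simp_all
  then have "Z \<noteq> f P" "Z \<noteq> f Q" using v w(1) by metis+
  ultimately have "X = f P \<or> X = f Q" by blast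
  then have "angle Y X Z = pi / 6 \<or> angle Y X Z = pi / 3" using v w(2) by metis
  then have "tan (pi / 6) = of_int e / of_int g \<or> tan (pi / 3) = of_int e / of_int g"
    using XYZ(3) by metis
  then have "1 / sqrt 3 \<in> \<rat> \<or> sqrt 3 \<in> \<rat>"
    unfolding tan_30 tan_60 by (metis Rats_divide Rats_of_int)
  moreover have "sqrt 3 = 1 / (1 / sqrt 3)" by simp
  ultimately show False using sqrt_3_irrational by (metis Rats_1 Rats_divide)
qed

theorem theorem2:
  fixes N :: nat and A B C :: point and T :: "point set" and \<T> :: "point set set"
  assumes "N > 0"
    and "is_triangle {A, B, C}"
    and "is_triangle T"
    and "similar T {A, B, C}"
    and "is_tiling N \<T> T {A, B, C}"
    and "\<not> (\<exists>m::nat. N = m\<^sup>2)"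
  shows "is_right_triangle T \<and> is_right_triangle {A, B, C} \<and>
    (three_times_square_case N T \<or> sum_of_squares_case N \<T> {A, B, C}) \<and>
    \<not> (three_times_square_case N T \<and> sum_of_squares_case N \<T> {A, B, C})"
proof -
  obtain k f where k: "k > 0" and f: "\<And>x y. dist (f x) (f y) = k * dist x y" and fT: "f ` T = {A, B, C}"
    using assms(4) unfolding similar_def by blast
  have N: "k\<^sup>2 = real N" using tiling_area[OF assms(5,3) fT f k] by simp
  have irr: "k \<notin> \<rat>" using nonsquare_root_irrational[OF N assms(6)] .
  obtain X Y Z where XYZ: "{A, B, C} = {X, Y, Z}" "vangle {A, B, C} X \<le> vangle {A, B, C} Y"
      "vangle {A, B, C} Y \<le> vangle {A, B, C} Z" using sort_vertices[of A B C "vangle {A, B, C}"] by (elim exE conjE)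
  define V where "V = {X, Y, Z}"
  have V: "is_triangle V" "card V = 3" "\<not> collinear {X, Y, Z}" using assms(2) unfolding XYZ(1) V_def is_triangle_def by simp_all
  have v: "vangle V X = angle Y X Z" "vangle V Y = angle X Y Z" "vangle V Z = angle X Z Y"
    using vangle_eq[of V X Y Z] vangle_eq[of V Y X Z] vangle_eq[of V Z X Y] V(2) by (auto simp: V_def insert_commute)
  have order: "angle Y X Z \<le> angle X Y Z" "angle X Y Z \<le> angle X Z Y"
    using XYZ(2,3) unfolding XYZ(1) V_def[symmetric] v .
  \<comment> \<open>Similarity relates unordered sets, so the vertices of the tile are labelled by
    preimages of the sorted vertices.\<close>
  obtain X' Y' Z' where X': "X' \<in> T" "f X' = X" "Y' \<in> T" "f Y' = Y" "Z' \<in> T" "f Z' = Z"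
    using fT unfolding XYZ(1) by (metis imageE insertCI)
  have "X' \<noteq> Y'" "X' \<noteq> Z'" "Y' \<noteq> Z'" using V(2) X' by (auto simp: V_def card_insert_if split: if_splits)
  then have "card {X', Y', Z'} = 3" by simp
  moreover have "card T = 3" using assms(3) by (simp add: is_triangle_def)
  ultimately have T: "T = {X', Y', Z'}" using X' by (metis card.infinite card_subset_eq zero_neq_numeral empty_subsetI insert_subset)
  let ?a = "dist Y' Z'" and ?b = "dist X' Z'" and ?c = "dist X' Y'"
  let ?\<alpha> = "angle Y X Z" and ?\<beta> = "angle X Y Z" and ?\<gamma> = "angle X Z Y"
  interpret similar_tiling X Y Z \<T> ?a ?b ?c ?\<alpha> ?\<beta> ?\<gamma> k
    using similar_triangle_tiling[of X Y Z X' Y' Z' N \<T> f k] V(1) assms(3,5) f k X' unfolding XYZ(1) T V_def by blast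
  have ang: "angle Y' X' Z' = ?\<alpha>" "angle X' Y' Z' = ?\<beta>" "angle X' Z' Y' = ?\<gamma>"
    using angle_similarity[OF f k, of Y' X' Z'] angle_similarity[OF f k, of X' Y' Z'] angle_similarity[OF f k, of X' Z' Y'] X' by simp_all
  have nc': "\<not> collinear {X', Y', Z'}" using assms(3) unfolding T is_triangle_def by simp
  have sum: "?\<alpha> + ?\<beta> + ?\<gamma> = pi" using triangle_trig(4)[OF V(3)] .
  have trig: "?a = ?c * sin ?\<alpha>" "?b = ?c * cos ?\<alpha>" if "?\<gamma> = pi / 2"
    using right_triangle_trig[OF nc'] that unfolding ang by simp_all
  have main: "?\<gamma> = pi / 2 \<and> (?\<alpha> = pi / 6 \<and> (\<exists>m::nat. N = 3 * m\<^sup>2) \<or>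
    splits_angle_at \<T> Z \<and> (\<exists>x y::nat. N = x\<^sup>2 + y\<^sup>2 \<and> ?a / ?b = real x / real y))"
    using sorted_case[OF order k N irr sum trig] .
  then have \<gamma>: "?\<gamma> = pi / 2" ..
  have "is_right_triangle T" using assms(3) \<gamma> ang(3) unfolding is_right_triangle_def T by metis
  moreover have "is_right_triangle {X, Y, Z}" using V(1) \<gamma> unfolding is_right_triangle_def V_def by blast
  moreover have "three_times_square_case N T \<or> sum_of_squares_case N \<T> {X, Y, Z}"
    using main[THEN conjunct2]
  proof
    assume *: "?\<alpha> = pi / 6 \<and> (\<exists>m::nat. N = 3 * m\<^sup>2)"
    then have "?\<beta> = pi / 3" using sum \<gamma> by simp
    then have "is_30_60_90_triangle T"
      using assms(3) * \<gamma> ang unfolding is_30_60_90_triangle_def T by metis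
    then show ?thesis using * by (simp add: three_times_square_case_def)
  next
    assume "splits_angle_at \<T> Z \<and> (\<exists>x y::nat. N = x\<^sup>2 + y\<^sup>2 \<and> ?a / ?b = real x / real y)"
    then obtain x y :: nat where split: "splits_angle_at \<T> Z" and xy: "N = x\<^sup>2 + y\<^sup>2" "?a / ?b = real x / real y" by blast
    have "tan ?\<alpha> = ?a / ?b" using trig[OF \<gamma>] pos(3) by (simp add: tan_def)
    then have tan\<alpha>: "tan ?\<alpha> = real x / real y" using xy(2) by simp
    have "?\<beta> = pi / 2 - ?\<alpha>" using sum \<gamma> by simp
    then have "tan ?\<beta> = inverse (tan ?\<alpha>)" by (simp add: tan_cot)
    then have "tan ?\<beta> = real y / real x" using tan\<alpha> by simp
    then have "sum_of_squares_case N \<T> {X, Y, Z}" unfolding sum_of_squares_case_def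
      using xy(1) \<gamma> tan\<alpha> split
      \<comment> \<open>The numbers come from \<open>right_triangle_sides\<close>, where they count
        the hypotenuses of tiles lying along the two legs.\<close>
      by (intro exI[of _ "int x"] exI[of _ "int y"] exI[of _ X] exI[of _ Y] exI[of _ Z]) simp
    then show ?thesis ..
  qed
  moreover have "\<not> (three_times_square_case N T \<and> sum_of_squares_case N \<T> {X, Y, Z})"
    using alternatives_exclusive[OF _ f k, of "{X, Y, Z}" T] V(1) fT unfolding XYZ(1) V_def by blast
  ultimately show ?thesis unfolding XYZ(1) by blast
qed

end
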